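(* For every mass ratio $m\ge 1$ there exists at least one twisted $(2,3)$-crown (a central configuration of the 6-body problem) with mass ratio $m$. Furthermore, there exist values $m^*,m^{**}>1$ such that: 1. for every $m\in(1,m^* )$ there exist exactly three different twisted $(2,3)$-crowns with mass ratio $m$, all of them with admissible values $a\in(1/z_2,z_2)$; 2. for every $m\in(m^{**},\infty)$ there exist exactly three different twisted $(2,3)$-crowns with mass ratio $m$, one of them with admissible value $a\in(1/z_2,1)$ and the other two with admissible values $a\in(1/z_1,\infty)$; 3. for every $m\in(m^*,m^{**})$ there exists only one twisted $(2,3)$-crown with mass ratio $m$, and its admissible value satisfies $a\in(1/z_2,1)$; 4. for $m=1$, $m=m^*$ and $m=m^{**}$ the number of different twisted $(2,3)$-crowns with mass ratio $m$ is exactly two. Here $z_1<z_2$ are the two positive zeros of $F$ for $n=3$.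
   Context: Let $n\ge 2$ be an integer. For $a>0$ and $m>0$ consider $2n$ bodies in the plane $\mathbb{R}^2\cong\mathbb{C}$: $n$ bodies of mass $1$ at the points $e^{2\pi i k/n}$, $k=0,\dots,n-1$, and $n$ bodies of mass $m$ at the points $a\,e^{i(\pi/n+2\pi k/n)}$, $k=0,\dots,n-1$. The center of mass is at the origin. Configuration $(q_i)$ with masses $(\mu_i)$ is a central configuration if there is $\lambda\in\mathbb{R}$ such that $\nabla_{q_i}U+\lambda\mu_i q_i=0$ for all $i$, where $U=\sum_{i<j}\mu_i\mu_j/\|q_i-q_j\|$. If the configuration of $2n$ bodies consisting of $n$ bodies of mass $1$ at the points $e^{2\pi i k/n}$ and $n$ bodies of mass $m$ at the points $a\,e^{i(\pi/n+2\pi k/n)}$, $k=0,\dots,n-1$, is central, it is called a twisted $(2,n)$-crown with radius (admissible value) $a$ and mass ratio $m$; it is encoded by the pair $(a,m)$. Put $S_n=\frac14\sum_{k=1}^{n-1}\frac{1}{\sin(k\pi/n)}$, $\theta_k=(2k-1)\pi/n$, and $$C_{12}(a)=\sum_{k=1}^n\frac{1-a\cos\theta_k}{(1+a^2-2a\cos\theta_k)^{3/2}},\qquad C_{21}(a)=\sum_{k=1}^n\frac{a-\cos\theta_k}{(1+a^2-2a\cos\theta_k)^{3/2}},$$ $$F(a)=S_na-C_{21}(a),\qquad G(a)=S_n-a^3C_{12}(a),\qquad H(a)=a^2\frac{F(a)}{G(a)}.$$ The configuration with parameters $(a,m)$ is a twisted $(2,n)$-crown if and only if $(C_{21}(a)-S_na)+\left(\frac{S_n}{a^2}-aC_{12}(a)\right)m=0$,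 that is, $m=H(a)$ when $G(a)\neq0$. The pair $(a,m)$ gives a twisted $(2,n)$-crown if and only if $(1/a,1/m)$ does, and these two are the same configuration up to scaling. Two crowns $(a,m)$ and $(a',m')$ are called different if $(a',m')\notin\{(a,m),(1/a,1/m)\}$. In particular, for fixed $m>1$ the number of different crowns is the number of $a>0$ with $H(a)=m$, while for $m=1$ the values $a$ and $1/a$ are identified. For $n=3$ the equation $F(a)=0$ has exactly two positive solutions, denoted $z_1<z_2$; they satisfy $3/8<z_1<7/16$ and $25/16<z_2<13/8$. *)

theory Defs
  imports "HOL-Analysis.Analysis"
begin

text \<open>
  The plane is identified with \<^typ>\<open>complex\<close>, with its usual real inner product. A configuration
  of \<open>N\<close> bodies is a function \<open>q\<close> on indices, of which only the values at \<open>i < N\<close> matter;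
  likewise for the masses \<open>\<mu>\<close>.
\<close>

definition potential :: "nat \<Rightarrow> (nat \<Rightarrow> real) \<Rightarrow> (nat \<Rightarrow> complex) \<Rightarrow> real" where
  "potential N \<mu> q = (\<Sum>j<N. \<Sum>i<j. \<mu> i * \<mu> j / norm (q i - q j))"

text \<open>
  The partial gradient of the potential with respect to \<open>q i\<close> is the gradient of the function
  that moves the \<open>i\<close>-th body only. Injectivity excludes collisions, where the potential is
  undefined and division by zero would yield a junk value.
\<close>

definition central_configuration :: "nat \<Rightarrow> (nat \<Rightarrow> real) \<Rightarrow> (nat \<Rightarrow> complex) \<Rightarrow> bool" where
  "central_configuration N \<mu> q \<longleftrightarrow>
     inj_on q {..<N} \<and>
     (\<exists>l::real. \<forall>i<N. \<exists>D.
        GDERIV (\<lambda>x. potential N \<mu> (q(i := x))) (q i) :> D \<and>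
        D + (l * \<mu> i) *\<^sub>R q i = 0)"

text \<open>Indices \<open>0..n-1\<close> form the ring of unit masses, indices \<open>n..2n-1\<close> the twisted ring.\<close>

definition crown_mass :: "nat \<Rightarrow> real \<Rightarrow> nat \<Rightarrow> real" where
  "crown_mass n m i = (if i < n then 1 else m)"

definition crown_position :: "nat \<Rightarrow> real \<Rightarrow> nat \<Rightarrow> complex" where
  "crown_position n a i =
     (if i < n then cis (2 * pi * real i / real n)
      else of_real a * cis (pi / real n + 2 * pi * real (i - n) / real n))"

definition twisted_crown :: "nat \<Rightarrow> real \<Rightarrow> real \<Rightarrow> bool" where
  "twisted_crown n a m \<longleftrightarrow>
     a > 0 \<and> m > 0 \<and> central_configuration (2 * n) (crown_mass n m) (crown_position n a)"

definition admissible_values :: "nat \<Rightarrow> real \<Rightarrow> real set" where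
  "admissible_values n m = {a. twisted_crown n a m}"

text \<open>
  The pairs \<open>(a, m)\<close> and \<open>(1/a, 1/m)\<close> encode the same configuration up to scaling. The relation
  is an equivalence (also at zero, since \<open>1/0 = 0\<close>). Different crowns of a given mass ratio
  are counted as equivalence classes; the identification has an effect only if \<open>m = 1\<close>.
\<close>

definition same_crown :: "((real \<times> real) \<times> (real \<times> real)) set" where
  "same_crown = {((a, m), (a', m')). (a', m') \<in> {(a, m), (1 / a, 1 / m)}}"

definition num_different_crowns :: "nat \<Rightarrow> real \<Rightarrow> nat" where
  "num_different_crowns n m = card (((\<lambda>a. (a, m)) ` admissible_values n m) // same_crown)"

definition Sn :: "nat \<Rightarrow> real" where
  "Sn n = 1 / 4 * (\<Sum>k=1..n - 1. 1 / sin (real k * pi / real n))"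

definition theta :: "nat \<Rightarrow> nat \<Rightarrow> real" where
  "theta n k = (2 * real k - 1) * pi / real n"

definition C21 :: "nat \<Rightarrow> real \<Rightarrow> real" where
  "C21 n a = (\<Sum>k=1..n. (a - cos (theta n k)) / (1 + a\<^sup>2 - 2 * a * cos (theta n k)) powr (3 / 2))"

definition Fn :: "nat \<Rightarrow> real \<Rightarrow> real" where
  "Fn n a = Sn n * a - C21 n a"

end

theory Submission
  imports Defs
begin

text \<open>
  The rotational symmetry of order three leaves one balance equation for each ring, and eliminating
  the multiplier turns a \<open>(2,3)\<close>-crown into a solution of \<open>a f(a) = m f(1/a)\<close>, where
  \<open>f = F\<close> is the net radial force on the unit ring (\<open>crown_force\<close>,
  \<open>twisted_crown_3_iff\<close>). Values of \<open>f\<close> at \<open>1/10, 1/2, 1, 2\<close> locate its two zeros in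
  \<open>z1 < 1/2\<close> and \<open>1 < z2 < 2\<close>, so \<open>f\<close> is positive, negative, positive. Since
  \<open>f(a)\<close> and \<open>f(1/a)\<close> must have equal signs, a crown has \<open>a\<close> in \<open>(1/z2, z2)\<close>, in
  \<open>(1/z1, \<infinity>)\<close> or in \<open>(0, z1)\<close>; in the last range \<open>a f(a) / f(1/a) < 20/21\<close>, which
  \<open>m \<ge> 1\<close> excludes.

  Counting rests on one principle: a quotient \<open>F/K\<close> of positive functions with
  \<open>F'' < 0 \<le> K''\<close> is strictly quasiconcave, and a continuous strictly quasiconcave function that
  vanishes at both ends of an interval takes a positive value twice, once or never according as the value is below,
  at or above its maximum.

  On \<open>(1/z1, \<infinity>)\<close> put \<open>b = 1/a < z1\<close>. The equation reads \<open>f(b) / K(b) = 1/m\<close> with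
  \<open>K(b) = f(1/b)/b\<close>; on \<open>(0, 1/2)\<close> the numerator is strictly concave and the denominator convex.
  If \<open>L\<close> is the maximum of the quotient then \<open>m** = 1/L\<close>, and \<open>L < 20/21\<close>.

  On \<open>(1/z2, z2)\<close> crude estimates fail: \<open>a f(a) / f(1/a)\<close> equals 1 at \<open>a = 1\<close> and its maximum
  over \<open>(1, z2)\<close> is only about 1.0008. The exact symmetry \<open>a \<leftrightarrow> 1/a\<close> removes this difficulty. With
  \<open>a = exp (2 arsinh u)\<close> one has \<open>sqrt a * f(a) = E(u) + u A(u)\<close>, where \<open>E\<close> and
  \<open>A\<close> are even (\<open>even_part\<close>, \<open>odd_factor\<close>), and the equation becomes
  \<open>(m + 1) u A(u) = (m - 1) E(u)\<close>. Both \<open>A\<close> and \<open>E\<close> increase for \<open>u > 0\<close>;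
  \<open>E < 0\<close> on the relevant range and \<open>A\<close> changes sign at some \<open>u0 < 1/10\<close>. For \<open>u < 0\<close>
  monotonicity yields exactly one solution. For \<open>u > 0\<close> and \<open>m > 1\<close> solutions need \<open>A < 0\<close>, hence
  \<open>u < u0\<close>, and there the principle applies to \<open>(-A) / (-E/u)\<close> with level
  \<open>(m - 1)/(m + 1)\<close>. If \<open>M\<close> is the maximum then \<open>m* = (1 + M)/(1 - M)\<close>, and \<open>M < 1/50\<close>
  gives \<open>m* < 51/49 < 21/20 < m**\<close>.
\<close>

section \<open>Central configurations and the attraction on a body\<close>

lemma GDERIV_inverse_distance:
  fixes p x :: "'a::real_inner"
  assumes "x \<noteq> p"
  shows "GDERIV (\<lambda>x. c / norm (x - p)) x :> (c / norm (p - x) ^ 3) *\<^sub>R (p - x)"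
proof -
  have "((\<lambda>x. norm (x - p)) has_derivative (\<lambda>h. h \<bullet> sgn (x - p))) (at x)"
    using has_derivative_compose[OF has_derivative_diff[OF has_derivative_ident has_derivative_const]
        GDERIV_norm[unfolded gderiv_def], of x p UNIV] assms by simp
  from has_derivative_divide[OF has_derivative_const[of c] this]
  have "((\<lambda>x. c / norm (x - p)) has_derivative (\<lambda>h. h \<bullet> ((c / norm (p - x) ^ 3) *\<^sub>R (p - x)))) (at x)"
    using assms
    by (simp add: sgn_div_norm norm_minus_commute[of p x] inner_diff_right field_simps power3_eq_cube)
  then show ?thesis by (simp add: gderiv_def)
qed

lemma GDERIV_sum:
  assumes "\<And>i. i \<in> I \<Longrightarrow> GDERIV (f i) x :> D i"
  shows "GDERIV (\<lambda>x. \<Sum>i\<in>I. f i x) x :> (\<Sum>i\<in>I. D i)"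
  using assms unfolding gderiv_def inner_sum_right by (intro has_derivative_sum) auto

definition attraction :: "nat \<Rightarrow> (nat \<Rightarrow> real) \<Rightarrow> (nat \<Rightarrow> complex) \<Rightarrow> nat \<Rightarrow> complex" where
  "attraction N \<mu> q i = (\<Sum>j\<in>{..<N} - {i}. (\<mu> i * \<mu> j / norm (q j - q i) ^ 3) *\<^sub>R (q j - q i))"

text \<open>
  In the double sum over \<open>k < j\<close> only the pairs that contain \<open>i\<close> depend on its position; the
  pairs with \<open>j = i\<close> contribute the bodies below \<open>i\<close>, those with \<open>k = i\<close> the bodies above.
\<close>

lemma GDERIV_potential:
  assumes inj: "inj_on q {..<N}" and i: "i < N"
  shows "GDERIV (\<lambda>x. potential N \<mu> (q(i := x))) (q i) :> attraction N \<mu> q i"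
proof -
  define D where "D j = (\<mu> i * \<mu> j / norm (q j - q i) ^ 3) *\<^sub>R (q j - q i)" for j
  have neq: "q i \<noteq> q j" if "j < N" "j \<noteq> i" for j
    using inj i that by (auto simp: inj_on_def)
  have D1: "GDERIV (\<lambda>x. \<mu> i * \<mu> j / norm (x - q j)) (q i) :> D j" if "j < N" "j \<noteq> i" for j
    unfolding D_def by (rule GDERIV_inverse_distance) (use neq that in auto)
  have pair: "GDERIV (\<lambda>x. \<mu> k * \<mu> j / norm ((q(i := x)) k - (q(i := x)) j)) (q i)
      :> ((if j = i then D k else 0) + (if k = i then D j else 0))" if "k < j" "j < N" for j k
    using D1[of j] D1[of k] that
    by (auto simp: norm_minus_commute[of "q k"] mult.commute GDERIV_const)
  have total: "GDERIV (\<lambda>x. potential N \<mu> (q(i := x))) (q i)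
      :> (\<Sum>j<N. \<Sum>k<j. (if j = i then D k else 0) + (if k = i then D j else 0))"
    unfolding potential_def by (intro GDERIV_sum pair) auto
  have inner: "(\<Sum>k<j. (if j = i then D k else 0) + (if k = i then D j else 0))
      = (if j = i then (\<Sum>k<i. D k) else 0) + (if j \<in> {i<..<N} then D j else 0)" if "j < N" for j
    using that by (auto simp: sum.distrib sum.delta)
  have "(\<Sum>j<N. \<Sum>k<j. (if j = i then D k else 0) + (if k = i then D j else 0))
      = (\<Sum>j<N. if j = i then (\<Sum>k<i. D k) else 0) + (\<Sum>j<N. if j \<in> {i<..<N} then D j else 0)"
    unfolding sum.distrib[symmetric] by (intro sum.cong refl, rule inner) simp
  also have "(\<Sum>j<N. if j = i then (\<Sum>k<i. D k) else 0) = (\<Sum>k<i. D k)"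
    using i by (simp add: sum.delta)
  also have "(\<Sum>j<N. if j \<in> {i<..<N} then D j else 0) = (\<Sum>j\<in>{..<N} \<inter> {i<..<N}. D j)"
    by (rule sum.inter_restrict[symmetric]) simp
  also have "{..<N} \<inter> {i<..<N} = {i<..<N}"
    by auto
  also have "(\<Sum>k<i. D k) + (\<Sum>j\<in>{i<..<N}. D j) = (\<Sum>j\<in>{..<i} \<union> {i<..<N}. D j)"
    by (rule sum.union_disjoint[symmetric]) auto
  also have "{..<i} \<union> {i<..<N} = {..<N} - {i}"
    using i by auto
  finally show ?thesis
    using total by (simp add: attraction_def D_def)
qed

lemma GDERIV_unique: "GDERIV f x :> D \<Longrightarrow> GDERIV f x :> D' \<Longrightarrow> D = D'"
  unfolding gderiv_def
  by (drule (1) has_derivative_unique, rule vector_eq_ldot[THEN iffD1]) (simp add: fun_eq_iff)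

lemma central_configuration_iff_attraction:
  "central_configuration N \<mu> q \<longleftrightarrow> inj_on q {..<N} \<and>
     (\<exists>l. \<forall>i<N. attraction N \<mu> q i + (l * \<mu> i) *\<^sub>R q i = 0)"
  (is "_ \<longleftrightarrow> ?inj \<and> ?bal")
proof -
  have "(\<exists>D. GDERIV (\<lambda>x. potential N \<mu> (q(i := x))) (q i) :> D \<and> D + v = 0)
      \<longleftrightarrow> attraction N \<mu> q i + v = 0" if ?inj "i < N" for i v
    using GDERIV_potential[OF that] GDERIV_unique by blast
  then show ?thesis
    unfolding central_configuration_def by (intro conj_cong refl) simp
qed

section \<open>The crown equation\<close>

lemma cis_thirds:
  "cis (2 * pi / 3) = Complex (- 1 / 2) (sqrt 3 / 2)"
  "cis (4 * pi / 3) = Complex (- 1 / 2) (- sqrt 3 / 2)"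
  "cis (pi / 3) = Complex (1 / 2) (sqrt 3 / 2)"
  "cis (5 * pi / 3) = Complex (1 / 2) (- sqrt 3 / 2)"
proof -
  have a: "pi / 3 = pi - 2 * pi / 3" "4 * pi / 3 = pi / 3 + pi" "5 * pi / 3 = 2 * pi - pi / 3"
    "2 * pi / 3 = pi - pi / 3"
    by simp_all
  show "cis (2 * pi / 3) = Complex (- 1 / 2) (sqrt 3 / 2)"
    unfolding a(4) by (simp only: complex_eq_iff cis.simps complex.sel cos_pi_minus sin_pi_minus cos_60 sin_60) simp
  show "cis (4 * pi / 3) = Complex (- 1 / 2) (- sqrt 3 / 2)"
    unfolding a(2) by (simp only: complex_eq_iff cis.simps complex.sel cos_periodic_pi sin_periodic_pi cos_60 sin_60) simp
  show "cis (pi / 3) = Complex (1 / 2) (sqrt 3 / 2)"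
    by (simp add: complex_eq_iff cos_60 sin_60)
  show "cis (5 * pi / 3) = Complex (1 / 2) (- sqrt 3 / 2)"
    unfolding a(3) by (simp only: complex_eq_iff cis.simps complex.sel cos_2pi_minus sin_2pi_minus cos_60 sin_60) simp
qed

lemma crown_position_3:
  "crown_position 3 a 0 = Complex 1 0"
  "crown_position 3 a (Suc 0) = Complex (- 1 / 2) (sqrt 3 / 2)"
  "crown_position 3 a 2 = Complex (- 1 / 2) (- sqrt 3 / 2)"
  "crown_position 3 a 3 = Complex (a / 2) (a * sqrt 3 / 2)"
  "crown_position 3 a 4 = Complex (- a) 0"
  "crown_position 3 a 5 = Complex (a / 2) (- a * sqrt 3 / 2)"
proof -
  have "pi / 3 + 2 * pi / 3 = pi" "pi / 3 + 4 * pi / 3 = 5 * pi / 3"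
    by simp_all
  then show
  "crown_position 3 a 0 = Complex 1 0"
  "crown_position 3 a (Suc 0) = Complex (- 1 / 2) (sqrt 3 / 2)"
  "crown_position 3 a 2 = Complex (- 1 / 2) (- sqrt 3 / 2)"
  "crown_position 3 a 3 = Complex (a / 2) (a * sqrt 3 / 2)"
  "crown_position 3 a 4 = Complex (- a) 0"
  "crown_position 3 a 5 = Complex (a / 2) (- a * sqrt 3 / 2)"
    by (simp_all add: crown_position_def cis_thirds complex_eq_iff del: cis.simps)
qed

text \<open>
  The function \<open>F\<close> for \<open>n = 3\<close> in closed form. Reciprocals are kept as factors because derivatives
  are polynomial in them.
\<close>

definition crown_force :: "real \<Rightarrow> real" where
  "crown_force a = a / sqrt 3 - (2 * a - 1) * inverse (sqrt (a\<^sup>2 - a + 1)) ^ 3 - inverse (1 + a) ^ 2"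

lemma Fn_3:
  assumes "a > 0"
  shows "Fn 3 a = crown_force a"
proof -
  have 1: "cos (theta 3 1) = 1 / 2" "cos (theta 3 2) = - 1" "cos (theta 3 3) = 1 / 2"
  proof -
    have t: "theta 3 1 = pi / 3" "theta 3 2 = pi" "theta 3 3 = 2 * pi - pi / 3"
      by (simp_all add: theta_def)
    show "cos (theta 3 1) = 1 / 2" "cos (theta 3 2) = - 1" "cos (theta 3 3) = 1 / 2"
      unfolding t by (simp_all only: cos_60 cos_2pi_minus cos_pi)
  qed
  have q: "a\<^sup>2 - a + 1 > 0"
    using sum_power2_ge_zero[of "a - 1/2" 0] by (simp add: power2_eq_square algebra_simps)
  have pw: "x powr (3 / 2) = sqrt x ^ 3" if "x > 0" for x :: real
    using that by (simp add: powr_half_sqrt[symmetric] powr_powr flip: powr_realpow)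
  have "sqrt ((1 + a)\<^sup>2) = 1 + a"
    using assms by simp
  then have p2: "(1 + a\<^sup>2 + 2 * a) powr (3 / 2) = (1 + a) ^ 3"
    using pw[of "(1 + a)\<^sup>2"] assms by (simp add: power2_sum add_pos_nonneg)
  have S: "Sn 3 = 1 / sqrt 3"
  proof -
    have "sin (2 * pi / 3) = sin (pi - pi / 3)" by simp
    then have si: "sin (2 * pi / 3) = sqrt 3 / 2" by (simp only: sin_pi_minus sin_60)
    have "Sn 3 = 1 / 4 * (1 / sin (pi / 3) + 1 / sin (2 * pi / 3))"
      by (simp add: Sn_def eval_nat_numeral)
    then show ?thesis unfolding si sin_60 by simp
  qed
  have I: "{1..3::nat} = {1, 2, 3}" by auto
  define X where "X = sqrt (a\<^sup>2 - a + 1) ^ 3"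
  have "C21 3 a = 2 * ((a - 1 / 2) / X) + (a + 1) / (1 + a) ^ 3"
    unfolding C21_def I X_def using p2 pw[OF q] 1 by (simp add: algebra_simps flip: add_divide_distrib)
  also have "(a + 1) / (1 + a) ^ 3 = 1 / (1 + a)\<^sup>2"
    using assms by (simp add: power3_eq_cube power2_eq_square add.commute)
  also have "2 * ((a - 1 / 2) / X) = (2 * a - 1) / X"
    by (simp add: right_diff_distrib)
  finally have "Fn 3 a = a / sqrt 3 - (2 * a - 1) / X - 1 / (1 + a)\<^sup>2"
    by (simp add: Fn_def S)
  then show ?thesis
    by (simp add: crown_force_def X_def inverse_eq_divide power_one_over)
qed

text \<open>
  Inversion \<open>a \<mapsto> 1/a\<close> exchanges the two rings, so \<open>f(1/a)\<close> describes the balance of the twisted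
  ring. Unlike \<open>f(1/a)\<close> the right hand side makes sense at \<open>a = 0\<close>, which gives continuity up to that point.
\<close>

lemma crown_force_inverse:
  assumes "a > 0"
  shows "a * crown_force (1 / a)
    = 1 / sqrt 3 - a ^ 3 * (2 - a) * inverse (sqrt (a\<^sup>2 - a + 1)) ^ 3 - a ^ 3 * inverse (1 + a) ^ 2"
proof -
  have "sqrt ((1 / a)\<^sup>2 - 1 / a + 1) = sqrt ((a\<^sup>2 - a + 1) / a\<^sup>2)"
    using assms by (intro arg_cong[of _ _ sqrt]) (simp add: power2_eq_square field_simps)
  then have r: "inverse (sqrt ((1 / a)\<^sup>2 - 1 / a + 1)) = a * inverse (sqrt (a\<^sup>2 - a + 1))"
    unfolding real_sqrt_divide using assms by (simp add: inverse_eq_divide)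
  have s: "inverse (1 + 1 / a) = a * inverse (1 + a)"
    using assms by (simp add: field_simps)
  define \<rho> \<sigma> where "\<rho> = inverse (sqrt (a\<^sup>2 - a + 1))" and "\<sigma> = inverse (1 + a)"
  have gen: "a * (x / t - p * w - z) = a * x / t - a * p * w - a * z" for x t p w z :: real
    by (simp add: right_diff_distrib)
  have c: "a * (1 / a) = 1" "a * (2 * (1 / a) - 1) = 2 - a"
    using assms by (simp_all add: right_diff_distrib)
  have "a * crown_force (1 / a) = a * (1 / a) / sqrt 3 - a * (2 * (1 / a) - 1) * (a * \<rho>) ^ 3 - a * (a * \<sigma>)\<^sup>2"
    unfolding crown_force_def r s \<rho>_def \<sigma>_def
    by (rule gen)
  also have "\<dots> = 1 / sqrt 3 - a ^ 3 * (2 - a) * \<rho> ^ 3 - a ^ 3 * \<sigma>\<^sup>2"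
    unfolding c by (simp add: power2_eq_square power3_eq_cube mult_ac)
  finally show ?thesis
    unfolding \<rho>_def \<sigma>_def .
qed

lemma cmod_eqI: "t \<ge> 0 \<Longrightarrow> x\<^sup>2 + y\<^sup>2 = t\<^sup>2 \<Longrightarrow> cmod (Complex x y) = t"
  by (simp add: complex_norm)

text \<open>
  By the symmetry of the crown the total attraction on each body is radial, with the same factor along
  a ring. Here \<open>\<alpha>\<close>, \<open>\<beta>\<close>, \<open>\<gamma>\<close> are the inverse cubes of the three kinds of
  distance: within the unit ring, between neighbours of different rings, and between opposite bodies. Distances within the second
  ring are \<open>a\<close> times those within the unit ring.
\<close>

lemma attraction_crown_3:
  fixes a m :: real
  assumes "a > 0"
  defines "q \<equiv> crown_position 3 a" and "\<beta> \<equiv> inverse (sqrt (a\<^sup>2 - a + 1) ^ 3)"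
    and "\<gamma> \<equiv> inverse ((1 + a) ^ 3)" and "\<alpha> \<equiv> inverse (sqrt 3 ^ 3)"
  shows "i < 3 \<Longrightarrow> attraction 6 (crown_mass 3 m) q i
      = - (3 * \<alpha> + m * ((2 - a) * \<beta> + (1 + a) * \<gamma>)) *\<^sub>R q i"
    and "i \<in> {3..<6} \<Longrightarrow> attraction 6 (crown_mass 3 m) q i
      = - (m * ((1 + a) * \<gamma> + (2 * a - 1) * \<beta> + 3 * m * \<alpha> / a\<^sup>2) / a) *\<^sub>R q i"
proof -
  let ?s = "sqrt 3" and ?r = "sqrt (a\<^sup>2 - a + 1)"
  have r2: "?r\<^sup>2 = a\<^sup>2 - a + 1"
    using sum_power2_ge_zero[of "a - 1/2" 0] by (simp add: power2_eq_square algebra_simps)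
  have r0: "?r \<ge> 0" using r2 by (metis abs_ge_zero real_sqrt_abs real_sqrt_ge_0_iff zero_le_power2)
  have q: "q 0 = Complex 1 0" "q (Suc 0) = Complex (- 1 / 2) (?s / 2)" "q 2 = Complex (- 1 / 2) (- ?s / 2)"
    "q 3 = Complex (a / 2) (a * ?s / 2)" "q 4 = Complex (- a) 0" "q 5 = Complex (a / 2) (- a * ?s / 2)"
    unfolding q_def by (rule crown_position_3)+
  have d: "cmod (q 0 - q (Suc 0)) = ?s" "cmod (q 0 - q 2) = ?s" "cmod (q (Suc 0) - q 2) = ?s"
    "cmod (q 3 - q 4) = a * ?s" "cmod (q 3 - q 5) = a * ?s" "cmod (q 4 - q 5) = a * ?s"
    "cmod (q 0 - q 4) = 1 + a" "cmod (q (Suc 0) - q 5) = 1 + a" "cmod (q 2 - q 3) = 1 + a"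
    "cmod (q 0 - q 3) = ?r" "cmod (q 0 - q 5) = ?r" "cmod (q (Suc 0) - q 3) = ?r"
    "cmod (q (Suc 0) - q 4) = ?r" "cmod (q 2 - q 4) = ?r" "cmod (q 2 - q 5) = ?r"
    unfolding q complex_diff using assms(1) r0 r2
    by (auto intro!: cmod_eqI simp: power2_eq_square algebra_simps)
  note d' = d d[THEN trans[OF norm_minus_commute]]
  have al: "inverse ((a * ?s) ^ 3) = \<alpha> * inverse (a ^ 3)"
    by (simp add: \<alpha>_def power_mult_distrib field_simps)
  have sets: "{..<6} - {0::nat} = {Suc 0, 2, 3, 4, 5}" "{..<6} - {Suc 0} = {0, 2, 3, 4, 5}"
    "{..<6} - {2::nat} = {0, Suc 0, 3, 4, 5}" "{..<6} - {3::nat} = {0, Suc 0, 2, 4, 5}"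
    "{..<6} - {4::nat} = {0, Suc 0, 2, 3, 5}" "{..<6} - {5::nat} = {0, Suc 0, 2, 3, 4}"
    by auto
  have att: "attraction 6 (crown_mass 3 m) q i = (\<Sum>j\<in>{..<6} - {i}.
      (crown_mass 3 m i * crown_mass 3 m j * inverse (cmod (q j - q i) ^ 3)) *\<^sub>R (q j - q i))" for i
    by (simp add: attraction_def divide_inverse)
  note unf = att sets d' al \<alpha>_def[symmetric] \<beta>_def[symmetric] \<gamma>_def[symmetric]
  have a0: "a \<noteq> 0" using assms by simp
  show "attraction 6 (crown_mass 3 m) q i
      = - (3 * \<alpha> + m * ((2 - a) * \<beta> + (1 + a) * \<gamma>)) *\<^sub>R q i" if "i < 3"
  proof -
    have "i = 0 \<or> i = Suc 0 \<or> i = 2" using that by auto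
    then show ?thesis
      by (elim disjE; simp add: unf crown_mass_def; simp add: q complex_eq_iff; simp add: field_simps)
  qed
  show "attraction 6 (crown_mass 3 m) q i
      = - (m * ((1 + a) * \<gamma> + (2 * a - 1) * \<beta> + 3 * m * \<alpha> / a\<^sup>2) / a) *\<^sub>R q i" if "i \<in> {3..<6}"
  proof -
    have "i = 3 \<or> i = 4 \<or> i = 5" using that by auto
    then show ?thesis
      by (elim disjE; simp add: unf crown_mass_def; simp add: q complex_eq_iff a0; simp add: field_simps a0 power2_eq_square power3_eq_cube)
  qed
qed

text \<open>
  As all attractions are radial, the multiplier has to equal the radial factor of either ring, and
  a crown is central exactly when the two factors agree.
\<close>

lemma twisted_crown_3_iff:
  "twisted_crown 3 a m \<longleftrightarrow> a > 0 \<and> m > 0 \<and> a * crown_force a = m * crown_force (1 / a)"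
proof (cases "a > 0 \<and> m > 0")
  case True
  then have a: "a > 0" and m: "m > 0" by auto
  define \<alpha> where "\<alpha> = inverse (sqrt 3 ^ 3)"
  define \<beta> where "\<beta> = inverse (sqrt (a\<^sup>2 - a + 1) ^ 3)"
  define \<gamma> where "\<gamma> = inverse ((1 + a) ^ 3)"
  define k1 where "k1 = 3 * \<alpha> + m * ((2 - a) * \<beta> + (1 + a) * \<gamma>)"
  define k2 where "k2 = ((1 + a) * \<gamma> + (2 * a - 1) * \<beta> + 3 * m * \<alpha> / a\<^sup>2) / a"
  let ?q = "crown_position 3 a"
  have q0: "?q i \<noteq> 0" for i
    using a by (simp add: crown_position_def)
  have inj: "inj_on ?q {..<6}"
  proof -
    have "{..<6} = {0, Suc 0, 2, 3, 4, 5}" by auto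
    then show ?thesis
      using a by (simp add: crown_position_3 complex_eq_iff)
  qed
  have "twisted_crown 3 a m \<longleftrightarrow> (\<exists>l. \<forall>i<6. attraction 6 (crown_mass 3 m) ?q i
      + (l * crown_mass 3 m i) *\<^sub>R ?q i = 0)"
    using a m inj by (simp add: twisted_crown_def central_configuration_iff_attraction)
  also have "\<dots> \<longleftrightarrow> (\<exists>l. \<forall>i<6. l * crown_mass 3 m i = (if i < 3 then k1 else m * k2))"
  proof -
    have "attraction 6 (crown_mass 3 m) ?q i + (l * crown_mass 3 m i) *\<^sub>R ?q i = 0
        \<longleftrightarrow> l * crown_mass 3 m i = (if i < 3 then k1 else m * k2)" if "i < 6" for i l
    proof -
      have "attraction 6 (crown_mass 3 m) ?q i = - (if i < 3 then k1 else m * k2) *\<^sub>R ?q i"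
      proof (cases "i < 3")
        case True
        then show ?thesis
          unfolding attraction_crown_3(1)[OF a True] by (simp only: k1_def \<alpha>_def \<beta>_def \<gamma>_def if_True)
      next
        case False
        then have "i \<in> {3..<6}" using that by auto
        then show ?thesis
          unfolding attraction_crown_3(2)[OF a \<open>i \<in> {3..<6}\<close>]
          using False by (simp only: k2_def \<alpha>_def \<beta>_def \<gamma>_def if_False times_divide_eq_right)
      qed
      then have "attraction 6 (crown_mass 3 m) ?q i + (l * crown_mass 3 m i) *\<^sub>R ?q i
          = (l * crown_mass 3 m i - (if i < 3 then k1 else m * k2)) *\<^sub>R ?q i"
        by (simp add: algebra_simps)
      then show ?thesis using q0[of i] by simp
    qed
    then show ?thesis by simp
  qed
  also have "\<dots> \<longleftrightarrow> k1 = k2"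
  proof
    assume "\<exists>l. \<forall>i<6. l * crown_mass 3 m i = (if i < 3 then k1 else m * k2)"
    then obtain l where l: "\<And>i. i < 6 \<Longrightarrow> l * crown_mass 3 m i = (if i < 3 then k1 else m * k2)"
      by blast
    show "k1 = k2"
      using l[of 0] l[of 3] m by (simp add: crown_mass_def)
  next
    assume "k1 = k2"
    then show "\<exists>l. \<forall>i<6. l * crown_mass 3 m i = (if i < 3 then k1 else m * k2)"
      by (intro exI[of _ k1]) (simp add: crown_mass_def)
  qed
  also have "\<dots> \<longleftrightarrow> a * crown_force a = m * crown_force (1 / a)"
  proof -
    have al: "3 * \<alpha> = 1 / sqrt 3"
      by (simp add: \<alpha>_def power3_eq_cube field_simps)
    have "\<gamma> = inverse (1 + a) * inverse (1 + a) ^ 2"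
      by (simp add: \<gamma>_def power3_eq_cube power2_eq_square)
    then have ga: "(1 + a) * \<gamma> = inverse (1 + a) ^ 2"
      using a by simp
    have be: "\<beta> = inverse (sqrt (a\<^sup>2 - a + 1)) ^ 3"
      by (simp add: \<beta>_def power_inverse)
    have F': "a * crown_force (1 / a) = 3 * \<alpha> - (2 - a) * a ^ 3 * \<beta> - a ^ 3 * ((1 + a) * \<gamma>)"
      unfolding al ga be crown_force_inverse[OF a] by simp
    have F: "crown_force a = 3 * \<alpha> * a - (2 * a - 1) * \<beta> - (1 + a) * \<gamma>"
      unfolding al ga be crown_force_def by simp
    have "a ^ 3 * k2 = a\<^sup>2 * (a * k2)"
      by (simp add: power2_eq_square power3_eq_cube)
    also have "a * k2 = (1 + a) * \<gamma> + (2 * a - 1) * \<beta> + 3 * m * \<alpha> / a\<^sup>2"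
      using a by (simp add: k2_def)
    also have "a\<^sup>2 * \<dots> = a\<^sup>2 * ((1 + a) * \<gamma> + (2 * a - 1) * \<beta>) + 3 * m * \<alpha>"
      using a by (simp add: distrib_left)
    finally have "a * (a * crown_force a) - m * (a * crown_force (1 / a)) = a ^ 3 * k1 - a ^ 3 * k2"
      unfolding F F' k1_def by (simp add: power2_eq_square power3_eq_cube algebra_simps)
    then have "a * (a * crown_force a - m * crown_force (1 / a)) = a ^ 3 * (k1 - k2)"
      by (simp add: right_diff_distrib mult.left_commute)
    then show ?thesis using a
      by (metis eq_iff_diff_eq_0 less_irrefl mult_eq_0_iff zero_less_power)
  qed
  finally show ?thesis using True by simp
qed (auto simp: twisted_crown_def)

section \<open>Level sets of quotients of concave by convex functions\<close>

text \<open>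
  Below the maximum the intermediate value theorem gives a solution on each side of the maximum
  point; a third one would be the middle one of three points on the same level, against strict quasiconcavity. The maximum
  is attained only once, since a second maximum point would force a larger value in between.
\<close>

lemma level_sets_of_unimodal:
  fixes W :: "real \<Rightarrow> real"
  assumes "p < q" and cont: "continuous_on {p..q} W" and W0: "W p = 0" "W q = 0"
    and pos: "\<And>x. p < x \<Longrightarrow> x < q \<Longrightarrow> W x > 0"
    and quasi: "\<And>x y z. p < x \<Longrightarrow> x < y \<Longrightarrow> y < z \<Longrightarrow> z < q \<Longrightarrow> W y > min (W x) (W z)"
  obtains M where "M > 0" and "M \<in> W ` {p<..<q}"
    and "\<And>c. 0 < c \<Longrightarrow> c < M \<Longrightarrow> card {x\<in>{p<..<q}. W x = c} = 2"
    and "card {x\<in>{p<..<q}. W x = M} = 1"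
    and "\<And>c. M < c \<Longrightarrow> {x\<in>{p<..<q}. W x = c} = {}"
proof -
  obtain t where t: "t \<in> {p..q}" "\<And>x. x \<in> {p..q} \<Longrightarrow> W x \<le> W t"
    using continuous_attains_sup[of "{p..q}" W] cont \<open>p < q\<close> by auto
  have "W t > 0"
    using t(2)[of "(p + q) / 2"] pos[of "(p + q) / 2"] \<open>p < q\<close> by auto
  then have tin: "p < t" "t < q"
    using t(1) W0 by (auto simp: order_less_le)
  show thesis
  proof (rule that[of "W t"])
    show "W t > 0" "W t \<in> W ` {p<..<q}"
      using \<open>W t > 0\<close> tin by auto
    show "{x\<in>{p<..<q}. W x = c} = {}" if "W t < c" for c
      using that t(2) by (auto simp: not_le[symmetric])
    have "x = t" if "p < x" "x < q" "W x = W t" for x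
    proof (rule ccontr)
      assume "x \<noteq> t"
      then have "p < min x t" "min x t < (x + t) / 2" "(x + t) / 2 < max x t" "max x t < q"
        using that tin by auto
      moreover from this have "W ((x + t) / 2) > min (W (min x t)) (W (max x t))"
        by (rule quasi)
      ultimately show False
        using t(2)[of "(x + t) / 2"] that by (auto simp: min_def max_def split: if_splits)
    qed
    then have "{x\<in>{p<..<q}. W x = W t} = {t}"
      using tin by auto
    then show "card {x\<in>{p<..<q}. W x = W t} = 1"
      by simp
    show "card {x\<in>{p<..<q}. W x = c} = 2" if c: "0 < c" "c < W t" for c
    proof -
      obtain x1 where x1: "p \<le> x1" "x1 \<le> t" "W x1 = c"
        using IVT'[of W p c t] c W0 tin continuous_on_subset[OF cont] by auto
      obtain x2 where x2: "t \<le> x2" "x2 \<le> q" "W x2 = c"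
        using IVT2'[of W q c t] c W0 tin continuous_on_subset[OF cont] by auto
      have lt: "p < x1" "x1 < t" "t < x2" "x2 < q"
        using x1 x2 c W0 by (auto simp: order_less_le)
      have no3: False if "p < x" "x < y" "y < z" "z < q" "W x = c" "W y = c" "W z = c" for x y z
        using quasi[OF that(1-4)] that by simp
      have "x = x1 \<or> x = x2" if "p < x" "x < q" "W x = c" for x
      proof (rule ccontr)
        assume "\<not> ?thesis"
        then consider "x < x1" | "x1 < x" "x < x2" | "x2 < x"
          by linarith
        then show False
          using no3[of x x1 x2] no3[of x1 x x2] no3[of x1 x2 x] that lt x1(3) x2(3)
          by cases auto
      qed
      then have "{x\<in>{p<..<q}. W x = c} = {x1, x2}"
        using lt x1 x2 by auto
      then show ?thesis
        using lt by simp
    qed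
  qed
qed

text \<open>
  With \<open>k\<close> the smaller one of the two outer values, \<open>F - k K\<close> is nonnegative at
  \<open>x\<close> and \<open>z\<close> and strictly concave, since \<open>k > 0\<close>; so it is positive in between.
\<close>

lemma quotient_strictly_quasiconcave:
  fixes F K :: "real \<Rightarrow> real"
  assumes F: "\<And>x. x \<in> {p<..<q} \<Longrightarrow> (F has_real_derivative F' x) (at x)"
    and F': "\<And>x. x \<in> {p<..<q} \<Longrightarrow> (F' has_real_derivative F'' x) (at x)"
    and K: "\<And>x. x \<in> {p<..<q} \<Longrightarrow> (K has_real_derivative K' x) (at x)"
    and K': "\<And>x. x \<in> {p<..<q} \<Longrightarrow> (K' has_real_derivative K'' x) (at x)"
    and F'': "\<And>x. x \<in> {p<..<q} \<Longrightarrow> F'' x < 0" and K'': "\<And>x. x \<in> {p<..<q} \<Longrightarrow> K'' x \<ge> 0"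
    and pos: "\<And>x. x \<in> {p<..<q} \<Longrightarrow> F x > 0" "\<And>x. x \<in> {p<..<q} \<Longrightarrow> K x > 0"
    and ord: "p < x" "x < y" "y < z" "z < q"
  shows "F y / K y > min (F x / K x) (F z / K z)"
proof -
  define k where "k = min (F x / K x) (F z / K z)"
  have xyz: "x \<in> {p<..<q}" "y \<in> {p<..<q}" "z \<in> {p<..<q}"
    using ord by auto
  have "k > 0"
    using pos xyz by (simp add: k_def)
  define P where "P t = F t - k * K t" for t
  define P' where "P' t = F' t - k * K' t" for t
  have dP: "(P has_real_derivative P' t) (at t)" if "t \<in> {p<..<q}" for t
    unfolding P_def P'_def by (intro DERIV_diff DERIV_cmult F K that)
  have dP': "(P' has_real_derivative (F'' t - k * K'' t)) (at t)" if "t \<in> {p<..<q}" for t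
    unfolding P'_def by (intro DERIV_diff DERIV_cmult F' K' that)
  have "k \<le> F x / K x" "k \<le> F z / K z"
    by (simp_all add: k_def)
  then have Pxz: "P x \<ge> 0" "P z \<ge> 0"
    using pos xyz by (auto simp: P_def pos_le_divide_eq)
  have "P y > 0"
  proof (rule ccontr)
    assume "\<not> P y > 0"
    obtain s where s: "x < s" "s < y" "P y - P x = (y - x) * P' s"
      using MVT2[of x y P P'] dP ord by auto
    obtain t where t: "y < t" "t < z" "P z - P y = (z - y) * P' t"
      using MVT2[of y z P P'] dP ord by auto
    have "(y - x) * P' s \<le> 0" "(z - y) * P' t \<ge> 0"
      using s t Pxz \<open>\<not> P y > 0\<close> by linarith+
    then have "P' s \<le> 0" "P' t \<ge> 0"
      using ord by (auto simp: mult_le_0_iff zero_le_mult_iff)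
    moreover have "P' t < P' s"
    proof (rule DERIV_neg_imp_decreasing[of s t P'])
      show "s < t" using s t by simp
      fix v assume v: "s \<le> v" "v \<le> t"
      then have vin: "v \<in> {p<..<q}" using s t ord by auto
      then show "\<exists>d. (P' has_real_derivative d) (at v) \<and> d < 0"
        using dP'[OF vin] F''[OF vin] mult_nonneg_nonneg[OF less_imp_le[OF \<open>k > 0\<close>] K''[OF vin]]
        by (intro exI[of _ "F'' v - k * K'' v"]) simp
    qed
    ultimately show False by simp
  qed
  then have "F y / K y > k"
    using pos xyz by (simp add: P_def pos_less_divide_eq)
  then show ?thesis by (simp add: k_def)
qed

section \<open>Concavity for small radii\<close>

lemma side_pos: "b\<^sup>2 - b + 1 > (0::real)"
  using sum_power2_ge_zero[of "b - 1/2" 0] by (simp add: power2_eq_square algebra_simps)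

lemma DERIV_inverse_sqrt:
  assumes "(f has_real_derivative d) (at x)" and "f x > 0"
  shows "((\<lambda>x. inverse (sqrt (f x))) has_real_derivative (- d / 2 * inverse (sqrt (f x)) ^ 3)) (at x)"
proof -
  have "((\<lambda>x. sqrt (f x)) has_real_derivative (inverse (sqrt (f x)) / 2 * d)) (at x)"
    by (rule DERIV_chain2[OF DERIV_real_sqrt assms(1)]) (rule assms(2))
  from DERIV_inverse'[OF this] show ?thesis
    using assms(2) by (simp add: power3_eq_cube mult_ac)
qed

lemma DERIV_inverse_one_plus:
  "b > 0 \<Longrightarrow> ((\<lambda>b::real. inverse (1 + b)) has_real_derivative - (inverse (1 + b) ^ 2)) (at b)"
  by (auto intro!: derivative_eq_intros simp: power2_eq_square)

text \<open>
  In terms of \<open>r = 1 / sqrt (b\<^sup>2 - b + 1)\<close> and \<open>s = 1/(1 + b)\<close> all functions and derivatives below are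
  polynomials, because \<open>r' = (1 - 2 b)/2 r\<^sup>3\<close> and \<open>s' = - s\<^sup>2\<close>.
\<close>

context
  fixes r s :: "real \<Rightarrow> real"
  defines "r \<equiv> \<lambda>b. inverse (sqrt (b\<^sup>2 - b + 1))" and "s \<equiv> \<lambda>b. inverse (1 + b)"
begin

private lemma dr: "(r has_real_derivative (1 - 2 * b) / 2 * r b ^ 3) (at b)"
proof -
  have "((\<lambda>b. b\<^sup>2 - b + 1) has_real_derivative (2 * b - 1)) (at b)"
    by (auto intro!: derivative_eq_intros)
  from DERIV_inverse_sqrt[OF this side_pos] show ?thesis
    by (simp add: r_def)
qed

private lemma ds: "b > 0 \<Longrightarrow> (s has_real_derivative - (s b ^ 2)) (at b)"
  unfolding s_def by (rule DERIV_inverse_one_plus)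

private lemma r_pos: "r b > 0"
  unfolding r_def using side_pos[of b] by simp

private lemma r_side: "r b ^ 2 * (b\<^sup>2 - b + 1) = 1"
  unfolding r_def power_inverse real_sqrt_pow2[OF less_imp_le[OF side_pos]] using side_pos[of b] by simp

private lemma s_pos: "b > 0 \<Longrightarrow> s b > 0"
  by (simp add: s_def)

text \<open>
  For the sign of the second derivative put \<open>w = 1 - 2 b\<close>. Then \<open>b\<^sup>2 - b + 1 = (3 + w\<^sup>2)/4\<close>, and the
  terms that contain \<open>r\<close> combine to \<open>w r\<^sup>7 (3/2 w\<^sup>2 - 27/4)\<close>, which is negative for
  \<open>0 < w < 1\<close>.
\<close>

private lemma crown_force_derivatives:
  assumes b: "0 < b" "b < 1 / 2"
  defines "F' \<equiv> \<lambda>b. 1 / sqrt 3 - 2 * r b ^ 3 + 3 / 2 * (1 - 2 * b) ^ 2 * r b ^ 5 + 2 * s b ^ 3"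
    and "F'' \<equiv> \<lambda>b. - 9 * (1 - 2 * b) * r b ^ 5 + 15 / 4 * (1 - 2 * b) ^ 3 * r b ^ 7 - 6 * s b ^ 4"
  shows "(crown_force has_real_derivative F' b) (at b)"
    and "(F' has_real_derivative F'' b) (at b)"
    and "F'' b < 0"
proof -
  define k where "k = 1 / sqrt 3"
  have cf: "crown_force = (\<lambda>b. k * b - (2 * b - 1) * r b ^ 3 - s b ^ 2)"
    by (simp add: fun_eq_iff crown_force_def r_def s_def k_def)
  show "(crown_force has_real_derivative F' b) (at b)"
    unfolding cf F'_def k_def[symmetric]
    by (rule derivative_eq_intros dr ds refl b)+ (simp add: algebra_simps eval_nat_numeral add_divide_distrib diff_divide_distrib)
  show "(F' has_real_derivative F'' b) (at b)"
    unfolding F'_def F''_def k_def[symmetric]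
    by (rule derivative_eq_intros dr ds refl b)+ (simp add: algebra_simps eval_nat_numeral add_divide_distrib diff_divide_distrib)
  define w where "w = 1 - 2 * b"
  have w: "0 < w" "w < 1" using b by (auto simp: w_def)
  have q: "b\<^sup>2 - b + 1 = (3 + w\<^sup>2) / 4"
    by (simp add: w_def power2_eq_square field_simps)
  have "r b ^ 5 = r b ^ 5 * (r b ^ 2 * (b\<^sup>2 - b + 1))"
    unfolding r_side by simp
  also have "\<dots> = r b ^ 7 * (b\<^sup>2 - b + 1)"
    by (simp add: power_add[symmetric] mult.assoc[symmetric])
  finally have r5: "r b ^ 5 = r b ^ 7 * ((3 + w\<^sup>2) / 4)"
    unfolding q .
  have "F'' b = w * r b ^ 7 * (3 / 2 * w\<^sup>2 - 27 / 4) - 6 * s b ^ 4"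
    unfolding F''_def r5 w_def[symmetric]
    by (simp add: power2_eq_square power3_eq_cube algebra_simps add_divide_distrib)
  moreover have "w\<^sup>2 < 1" using w by (simp add: power_less_one_iff)
  then have "w * r b ^ 7 * (3 / 2 * w\<^sup>2 - 27 / 4) < 0"
    using w r_pos[of b] by (intro mult_pos_neg) auto
  ultimately show "F'' b < 0"
    using s_pos[of b] b by (smt (verit) zero_less_power)
qed

lemma crown_force_strictly_concave:
  obtains F' F'' where
    "\<And>b. 0 < b \<Longrightarrow> b < 1 / 2 \<Longrightarrow> (crown_force has_real_derivative F' b) (at b)"
    "\<And>b. 0 < b \<Longrightarrow> b < 1 / 2 \<Longrightarrow> (F' has_real_derivative F'' b) (at b)"
    "\<And>b. 0 < b \<Longrightarrow> b < 1 / 2 \<Longrightarrow> F'' b < 0"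
  by (rule that[OF crown_force_derivatives])

text \<open>
  The leading term \<open>6/(sqrt 3 b\<^sup>4)\<close> of the second derivative is at least 48 on \<open>(0, 1/2)\<close>, while
  \<open>r \<le> 7/6\<close> bounds the negative terms by 25. The function is \<open>f(1/b)/b\<close>.
\<close>

private lemma reflected_force_derivatives:
  assumes b: "0 < b" "b < 1 / 2"
  defines "K \<equiv> \<lambda>b. 1 / sqrt 3 * inverse b ^ 2 - (2 - b) * b * r b ^ 3 - b * s b ^ 2"
    and "K' \<equiv> \<lambda>b. - 2 / sqrt 3 * inverse b ^ 3 - (2 - 2 * b) * r b ^ 3 - 3 / 2 * (2 * b - b ^ 2) * (1 - 2 * b) * r b ^ 5
      - s b ^ 2 + 2 * b * s b ^ 3"
    and "K'' \<equiv> \<lambda>b. 6 / sqrt 3 * inverse b ^ 4 + 2 * r b ^ 3 - 3 * (2 - 2 * b) * (1 - 2 * b) * r b ^ 5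
      + 3 * (2 * b - b ^ 2) * r b ^ 5 - 15 / 4 * (2 * b - b ^ 2) * (1 - 2 * b) ^ 2 * r b ^ 7 + (4 - 2 * b) * s b ^ 4"
  shows "(K has_real_derivative K' b) (at b)"
    and "(K' has_real_derivative K'' b) (at b)"
    and "K'' b \<ge> 0"
proof -
  define k where "k = 1 / sqrt 3"
  have k: "2 / sqrt 3 = 2 * k" "6 / sqrt 3 = 6 * k" "- 2 / sqrt 3 = - 2 * k"
    by (simp_all add: k_def)
  have b0: "b \<noteq> 0" using b by simp
  have s1: "s b * (1 + b) = 1" using b by (simp add: s_def)
  have di: "(inverse has_real_derivative - (inverse b ^ 2)) (at b)"
    using DERIV_inverse[OF b0] by (simp add: eval_nat_numeral)
  show "(K has_real_derivative K' b) (at b)"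
    unfolding K_def K'_def k k_def[symmetric]
    by (rule derivative_eq_intros dr ds di refl b b0)+ (simp add: algebra_simps eval_nat_numeral add_divide_distrib diff_divide_distrib)
  have "s b ^ 3 = s b ^ 3 * (s b * (1 + b))"
    unfolding s1 by simp
  also have "\<dots> = s b ^ 4 * (1 + b)"
    by (simp add: eval_nat_numeral mult.assoc[symmetric])
  finally have "s b ^ 3 = s b ^ 4 * (1 + b)" .
  then have s4: "(4 - 2 * b) * s b ^ 4 = 4 * s b ^ 3 - 6 * b * s b ^ 4"
    by (simp add: algebra_simps)
  show "(K' has_real_derivative K'' b) (at b)"
    unfolding K'_def K''_def s4 k k_def[symmetric]
    by (rule derivative_eq_intros dr ds di refl b b0)+ (simp add: algebra_simps eval_nat_numeral add_divide_distrib diff_divide_distrib)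
  have "b\<^sup>2 - b + 1 \<ge> 3 / 4"
    using sum_power2_ge_zero[of "b - 1/2" 0] by (simp add: power2_eq_square algebra_simps)
  then have "r b ^ 2 * (3 / 4) \<le> r b ^ 2 * (b\<^sup>2 - b + 1)"
    by (intro mult_left_mono) auto
  then have "r b ^ 2 \<le> (7 / 6)\<^sup>2"
    unfolding r_side by (simp add: power2_eq_square)
  then have r: "r b \<le> 7 / 6"
    by (rule power2_le_imp_le) simp
  have "r b ^ 5 \<le> (7 / 6) ^ 5" "r b ^ 7 \<le> (7 / 6) ^ 7"
    using r r_pos[of b] by (auto intro!: power_mono)
  moreover have "(7 / 6) ^ 5 \<le> (11 / 5 :: real)" "(7 / 6) ^ 7 \<le> (3 :: real)"
    by (simp_all add: eval_nat_numeral)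
  ultimately have r5: "r b ^ 5 \<le> 11 / 5" and r7: "r b ^ 7 \<le> 3"
    by linarith+
  have "(2 - 2 * b) * (1 - 2 * b) * r b ^ 5 \<le> 2 * 1 * (11 / 5)"
    using r5 b r_pos[of b] by (intro mult_mono) auto
  moreover have b2: "0 \<le> 2 * b - b ^ 2" "2 * b - b ^ 2 \<le> 1"
    using b sum_power2_ge_zero[of "b - 1" 0] by (auto simp: power2_eq_square algebra_simps)
  moreover have "(2 * b - b ^ 2) * (1 - 2 * b) ^ 2 * r b ^ 7 \<le> 1 * 1 * 3"
    using r7 b r_pos[of b] b2 by (intro mult_mono power_le_one) auto
  moreover have "6 / sqrt 3 * inverse b ^ 4 \<ge> 3 * 16"
  proof (rule mult_mono)
    have "sqrt 3 \<le> 2" by (rule real_le_lsqrt) auto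
    then show "3 \<le> 6 / sqrt 3" by (simp add: pos_le_divide_eq)
    have "2 \<le> inverse b" using b by (simp add: field_simps)
    then have "2 ^ 4 \<le> inverse b ^ 4" by (intro power_mono) auto
    then show "16 \<le> inverse b ^ 4" by simp
  qed auto
  moreover have "r b ^ 3 \<ge> 0" "(2 * b - b ^ 2) * r b ^ 5 \<ge> 0" "(4 - 2 * b) * s b ^ 4 \<ge> 0"
    using b b2 r_pos[of b] s_pos[of b] by auto
  ultimately show "K'' b \<ge> 0"
    unfolding K''_def mult.assoc by linarith
qed

lemma reflected_force_convex:
  obtains K' K'' where
    "\<And>b. 0 < b \<Longrightarrow> b < 1 / 2 \<Longrightarrow> ((\<lambda>b. 1 / sqrt 3 * inverse b ^ 2 - (2 - b) * b * r b ^ 3 - b * s b ^ 2)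
        has_real_derivative K' b) (at b)"
    "\<And>b. 0 < b \<Longrightarrow> b < 1 / 2 \<Longrightarrow> (K' has_real_derivative K'' b) (at b)"
    "\<And>b. 0 < b \<Longrightarrow> b < 1 / 2 \<Longrightarrow> K'' b \<ge> 0"
  by (rule that[OF reflected_force_derivatives])

lemma inv_sqrt_3_ge: "1 / sqrt 3 \<ge> 577 / 1000" and inv_sqrt_3_le: "1 / sqrt 3 \<le> 578 / 1000"
proof -
  have "sqrt 3 \<le> 1000 / 577" by (rule real_le_lsqrt) (auto simp: power2_eq_square)
  then show "1 / sqrt 3 \<ge> 577 / 1000" by (simp add: pos_le_divide_eq)
  have "sqrt 3 \<ge> 1000 / 578" by (rule real_le_rsqrt) (auto simp: power2_eq_square)
  then show "1 / sqrt 3 \<le> 578 / 1000" by (simp add: pos_divide_le_eq)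
qed

text \<open>
  For \<open>f(1/b) > 0\<close> this is \<open>b f(b) / f(1/b) < 20/21\<close>. The bound has two uses: it excludes crowns with \<open>a < z1\<close>, and it keeps
  \<open>m**\<close> above \<open>21/20\<close>. The numerator is estimated by
  \<open>(1 - 2 b) r\<^sup>3 \<le> (1 - 2 b) r\<^sup>4 = 16 w / (3 + w\<^sup>2)\<^sup>2 \<le> 1\<close> with \<open>w = 1 - 2 b\<close>.
\<close>

lemma outer_quotient_bound:
  assumes b: "0 < b" "b < 1 / 2"
  shows "21 * (b\<^sup>2 * crown_force b) < 20 * (b * crown_force (1 / b))"
proof -
  define w where "w = 1 - 2 * b"
  have w: "0 < w" "w < 1" using b by (auto simp: w_def)
  have q: "b\<^sup>2 - b + 1 = (3 + w\<^sup>2) / 4"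
    by (simp add: w_def power2_eq_square field_simps)
  have r2: "r b ^ 2 * (3 + w\<^sup>2) = 4"
    using r_side[of b] unfolding q by simp
  have "(3 + w\<^sup>2)\<^sup>2 - 16 * w = (1 - w)\<^sup>2 * (w\<^sup>2 + 2 * w + 9)"
    by (simp add: power2_eq_square algebra_simps)
  also have "\<dots> \<ge> 0" using w by auto
  finally have w16: "16 * w \<le> (3 + w\<^sup>2)\<^sup>2" by simp
  have w1: "w\<^sup>2 \<le> 1" using w by (simp add: power_le_one)
  have r1: "1 \<le> r b"
  proof (rule ccontr)
    assume "\<not> 1 \<le> r b"
    then have "r b ^ 2 < 1" using r_pos[of b] by (simp add: power_less_one_iff)
    then have "r b ^ 2 * (3 + w\<^sup>2) < 1 * 4"
      using w1 by (intro mult_less_le_imp_less) (auto simp: add_pos_nonneg)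
    then show False using r2 by simp
  qed
  have "w * r b ^ 3 \<le> w * r b ^ 4"
    using w r1 by (intro mult_left_mono power_increasing) auto
  also have "r b ^ 4 = (r b ^ 2)\<^sup>2" by simp
  also have "w * (r b ^ 2)\<^sup>2 \<le> (3 + w\<^sup>2)\<^sup>2 / 16 * (r b ^ 2)\<^sup>2"
    using w16 by (intro mult_right_mono) auto
  also have "\<dots> = (r b ^ 2 * (3 + w\<^sup>2))\<^sup>2 / 16"
    by (simp add: power_mult_distrib)
  also have "\<dots> = 1" unfolding r2 by simp
  finally have wr: "w * r b ^ 3 \<le> 1" .
  have "r b ^ 2 * 3 \<le> r b ^ 2 * (3 + w\<^sup>2)" by (intro mult_left_mono) auto
  then have "r b ^ 2 \<le> (7 / 6)\<^sup>2" using r2 by (simp add: power2_eq_square)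
  then have "r b \<le> 7 / 6" by (rule power2_le_imp_le) simp
  then have "r b ^ 3 \<le> (7 / 6) ^ 3" using r_pos[of b] by (intro power_mono) auto
  also have "(7 / 6 :: real) ^ 3 \<le> 1589 / 1000" by (simp add: power3_eq_cube)
  finally have r3: "r b ^ 3 \<le> 1589 / 1000" .
  have s: "2 / 3 \<le> s b" "b * s b \<le> 1 / 3"
    using b by (auto simp: s_def field_simps)
  have s2: "4 / 9 \<le> s b ^ 2"
    using power_mono[OF s(1), of 2] by (simp add: power2_eq_square)
  have bs: "b ^ 3 * s b ^ 2 \<le> 1 / 18"
  proof -
    have "b * (b * s b)\<^sup>2 \<le> 1 / 2 * (1 / 3)\<^sup>2"
      using b s s_pos[of b] by (intro mult_mono power_mono) auto
    then show ?thesis by (simp add: power2_eq_square power3_eq_cube mult_ac)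
  qed
  have b2: "b\<^sup>2 \<le> 1 / 4"
    using power_mono[of b "1 / 2" 2] b by (simp add: power2_eq_square)
  have "b * (2 - b) \<le> 3 / 4"
  proof -
    have "(1 / 2 - b) * (3 / 2 - b) \<ge> 0" using b by (intro mult_nonneg_nonneg) auto
    also have "(1 / 2 - b) * (3 / 2 - b) = 3 / 4 - b * (2 - b)"
      by (simp add: algebra_simps diff_divide_distrib)
    finally show ?thesis by simp
  qed
  then have "b\<^sup>2 * (b * (2 - b)) \<le> 1 / 4 * (3 / 4)"
    using b2 b by (intro mult_mono) auto
  then have "b ^ 3 * (2 - b) \<le> 3 / 16"
    by (simp add: power2_eq_square power3_eq_cube algebra_simps)
  then have br: "b ^ 3 * (2 - b) * r b ^ 3 \<le> 3 / 16 * (1589 / 1000)"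
    using r3 b r_pos[of b] by (intro mult_mono) auto
  define k where "k = 1 / sqrt 3"
  have k: "577 / 1000 \<le> k" "k \<le> 578 / 1000"
    unfolding k_def by (rule inv_sqrt_3_ge inv_sqrt_3_le)+
  have "b * k \<le> 1 / 2 * k" using b k by (intro mult_right_mono) auto
  moreover have "crown_force b = b * k + w * r b ^ 3 - s b ^ 2"
    by (simp add: crown_force_def r_def s_def k_def w_def algebra_simps)
  ultimately have "crown_force b \<le> k / 2 + 5 / 9"
    using wr s2 by linarith
  then have "b\<^sup>2 * crown_force b \<le> b\<^sup>2 * (k / 2 + 5 / 9)"
    by (intro mult_left_mono) auto
  also have "\<dots> \<le> 1 / 4 * (k / 2 + 5 / 9)"
    using b2 k by (intro mult_right_mono) auto
  finally have "21 * (b\<^sup>2 * crown_force b) \<le> 21 * (1 / 4 * (k / 2 + 5 / 9))"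
    by (rule mult_left_mono) simp
  also have "\<dots> < 20 * (k - b ^ 3 * (2 - b) * r b ^ 3 - b ^ 3 * s b ^ 2)"
  proof -
    have "21 * (1 / 4 * (k / 2 + 5 / 9)) < 20 * (k - P - Q)"
      if "P \<le> 3 / 16 * (1589 / 1000)" "Q \<le> 1 / 18" for P Q
      using that k by (simp add: field_simps)
    from this[OF br bs] show ?thesis .
  qed
  also have "k - b ^ 3 * (2 - b) * r b ^ 3 - b ^ 3 * s b ^ 2 = b * crown_force (1 / b)"
    unfolding crown_force_inverse[OF b(1)] by (simp add: r_def s_def k_def)
  finally show ?thesis .
qed

end

lemma continuous_on_crown_force: "continuous_on {0..} crown_force"
proof -
  have "sqrt (b\<^sup>2 - b + 1) \<noteq> 0" for b :: real
    using side_pos[of b] by simp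
  then show ?thesis
    unfolding crown_force_def by (intro continuous_intros) auto
qed

text \<open>
  The quotient is written with \<open>b f(1/b)\<close> in the form of \<open>crown_force_inverse\<close>, which is positive
  and continuous up to \<open>b = 0\<close>, so that it vanishes at both ends of \<open>[0, z]\<close>.
\<close>

lemma outer_level_sets:
  assumes z: "0 < z" "z < 1 / 2" "crown_force z = 0"
    and F: "\<And>b. 0 < b \<Longrightarrow> b < z \<Longrightarrow> crown_force b > 0"
    and G: "\<And>b. 0 < b \<Longrightarrow> b \<le> z \<Longrightarrow> crown_force (1 / b) > 0"
  obtains M where "0 < M" and "M < 20 / 21"
    and "\<And>c. 0 < c \<Longrightarrow> c < M \<Longrightarrow> card {b\<in>{0<..<z}. b * crown_force b = c * crown_force (1 / b)} = 2"
    and "card {b\<in>{0<..<z}. b * crown_force b = M * crown_force (1 / b)} = 1"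
    and "\<And>c. M < c \<Longrightarrow> {b\<in>{0<..<z}. b * crown_force b = c * crown_force (1 / b)} = {}"
proof -
  define R where "R b = 1 / sqrt 3 - b ^ 3 * (2 - b) * inverse (sqrt (b\<^sup>2 - b + 1)) ^ 3
    - b ^ 3 * inverse (1 + b) ^ 2" for b :: real
  define W where "W b = b\<^sup>2 * crown_force b / R b" for b
  define K where "K = (\<lambda>b::real. 1 / sqrt 3 * inverse b ^ 2 - (2 - b) * b * inverse (sqrt (b\<^sup>2 - b + 1)) ^ 3
    - b * inverse (1 + b) ^ 2)"
  have R: "R b = b * crown_force (1 / b)" if "b > 0" for b
    unfolding R_def crown_force_inverse[OF that] ..
  have R_pos: "R b > 0" if "0 \<le> b" "b \<le> z" for b
    using R[of b] G[of b] that by (cases "b = 0") (auto simp: R_def)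
  have K: "R b = b\<^sup>2 * K b" if "b > 0" for b
    using that by (simp add: R_def K_def right_diff_distrib power2_eq_square power3_eq_cube mult_ac)
  have K_pos: "K b > 0" if "0 < b" "b < z" for b
    using R_pos[of b] K[of b] that by (simp add: zero_less_mult_iff)
  have W_K: "W b = crown_force b / K b" if "0 < b" for b
    using K[OF that] that by (simp add: W_def)
  have W_eq: "W b = c \<longleftrightarrow> b * crown_force b = c * crown_force (1 / b)" if "b \<in> {0<..<z}" for b c
    using that G[of b] R[of b] by (auto simp: W_def power2_eq_square field_simps)
  obtain F' F'' where F12:
    "\<And>b. 0 < b \<Longrightarrow> b < 1 / 2 \<Longrightarrow> (crown_force has_real_derivative F' b) (at b)"
    "\<And>b. 0 < b \<Longrightarrow> b < 1 / 2 \<Longrightarrow> (F' has_real_derivative F'' b) (at b)"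
    "\<And>b. 0 < b \<Longrightarrow> b < 1 / 2 \<Longrightarrow> F'' b < 0"
    by (rule crown_force_strictly_concave) blast
  obtain K' K'' where K12:
    "\<And>b. 0 < b \<Longrightarrow> b < 1 / 2 \<Longrightarrow> (K has_real_derivative K' b) (at b)"
    "\<And>b. 0 < b \<Longrightarrow> b < 1 / 2 \<Longrightarrow> (K' has_real_derivative K'' b) (at b)"
    "\<And>b. 0 < b \<Longrightarrow> b < 1 / 2 \<Longrightarrow> K'' b \<ge> 0"
    unfolding K_def by (rule reflected_force_convex) blast
  have sq: "sqrt (b\<^sup>2 - b + 1) \<noteq> 0" for b :: real
    using side_pos[of b] by simp
  have "continuous_on {0..z} R"
    unfolding R_def using sq by (intro continuous_intros) auto
  then have cont: "continuous_on {0..z} W"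
    unfolding W_def using R_pos
    by (intro continuous_intros continuous_on_subset[OF continuous_on_crown_force]) (auto simp: less_le)
  have quasi: "W y > min (W x) (W v)" if ord: "0 < x" "x < y" "y < v" "v < z" for x y v
  proof -
    have "crown_force y / K y > min (crown_force x / K x) (crown_force v / K v)"
      by (rule quotient_strictly_quasiconcave[OF _ _ _ _ _ _ _ _ ord, where F' = F' and F'' = F'' and K' = K' and K'' = K''])
         (use F12 K12 F K_pos z in auto)
    then show ?thesis using ord by (simp add: W_K)
  qed
  obtain M where M: "M > 0" "M \<in> W ` {0<..<z}"
    "\<And>c. 0 < c \<Longrightarrow> c < M \<Longrightarrow> card {x\<in>{0<..<z}. W x = c} = 2"
    "card {x\<in>{0<..<z}. W x = M} = 1" "\<And>c. M < c \<Longrightarrow> {x\<in>{0<..<z}. W x = c} = {}"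
  proof (rule level_sets_of_unimodal[of 0 z W])
    show "W x > 0" if "0 < x" "x < z" for x
      using that F[of x] R_pos[of x] by (simp add: W_def)
  qed (use z cont quasi in \<open>auto simp: W_def\<close>)
  have sets: "{x\<in>{0<..<z}. W x = c} = {b\<in>{0<..<z}. b * crown_force b = c * crown_force (1 / b)}" for c
    using W_eq by blast
  have "M < 20 / 21"
  proof -
    obtain b where b: "0 < b" "b < z" "M = W b" using M(2) by auto
    then have "21 * (b\<^sup>2 * crown_force b) < 20 * R b"
      using outer_quotient_bound[of b] z R[of b] by simp
    then show ?thesis
      using b R_pos[of b] by (simp add: W_def divide_less_eq)
  qed
  with M show ?thesis unfolding sets by (intro that)
qed

section \<open>Even and odd parts near the unit radius\<close>

text \<open>
  For \<open>a = exp (2 arsinh u)\<close> the function \<open>sqrt a * crown_force a\<close> has an even part in \<open>u\<close>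
  and an odd part, and the odd part is \<open>u\<close> times an elementary even function.
\<close>

definition even_part :: "real \<Rightarrow> real" where
  "even_part u = sqrt (1 + u\<^sup>2) * (1 + 4 * u\<^sup>2) / sqrt 3 - inverse (sqrt (1 + u\<^sup>2)) / 4
     - (1 - 2 * u\<^sup>2) * inverse (sqrt (1 + 4 * u\<^sup>2)) ^ 3"

definition odd_factor :: "real \<Rightarrow> real" where
  "odd_factor u = (3 + 4 * u\<^sup>2) / sqrt 3 - 2 * sqrt (1 + u\<^sup>2) * inverse (sqrt (1 + 4 * u\<^sup>2)) ^ 3
     + inverse (sqrt (1 + u\<^sup>2)) ^ 2 / 4"

text \<open>
  Again the functions are polynomials in auxiliary ones with polynomial derivatives: \<open>C' = u c\<close>,
  \<open>c' = - u c\<^sup>3\<close>, \<open>\<rho>' = - 4 u \<rho>\<^sup>3\<close>, all three between 0 and \<open>1 + u\<^sup>2\<close>.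
\<close>

context
  fixes k :: real and C c \<rho> :: "real \<Rightarrow> real"
  defines "k \<equiv> 1 / sqrt 3" and "C \<equiv> \<lambda>u. sqrt (1 + u\<^sup>2)" and "c \<equiv> \<lambda>u. inverse (sqrt (1 + u\<^sup>2))"
    and "\<rho> \<equiv> \<lambda>u. inverse (sqrt (1 + 4 * u\<^sup>2))"
begin

private lemma k_bounds: "577 / 1000 \<le> k" "k \<le> 578 / 1000"
  unfolding k_def by (rule inv_sqrt_3_ge inv_sqrt_3_le)+

private lemma dC: "(C has_real_derivative u * c u) (at u)"
proof -
  have "((\<lambda>u. 1 + u\<^sup>2) has_real_derivative 2 * u) (at u)"
    by (auto intro!: derivative_eq_intros)
  from DERIV_chain2[OF DERIV_real_sqrt this] show ?thesis
    by (simp add: C_def c_def add_pos_nonneg mult_ac)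
qed

private lemma dc: "(c has_real_derivative - u * c u ^ 3) (at u)"
proof -
  have "((\<lambda>u. 1 + u\<^sup>2) has_real_derivative 2 * u) (at u)"
    by (auto intro!: derivative_eq_intros)
  from DERIV_inverse_sqrt[OF this] show ?thesis
    by (simp add: c_def add_pos_nonneg)
qed

private lemma d\<rho>: "(\<rho> has_real_derivative - 4 * u * \<rho> u ^ 3) (at u)"
proof -
  have "((\<lambda>u. 1 + 4 * u\<^sup>2) has_real_derivative 8 * u) (at u)"
    by (auto intro!: derivative_eq_intros)
  from DERIV_inverse_sqrt[OF this] show ?thesis
    by (simp add: \<rho>_def add_pos_nonneg)
qed

private lemma bounds: "1 \<le> C u" "C u \<le> 1 + u\<^sup>2" "0 < c u" "c u \<le> 1" "0 < \<rho> u" "\<rho> u \<le> 1"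
proof -
  show "1 \<le> C u" unfolding C_def by (rule real_le_rsqrt) simp
  show "C u \<le> 1 + u\<^sup>2" unfolding C_def by (rule real_le_lsqrt) (auto intro: self_le_power)
  show "0 < c u" "0 < \<rho> u" unfolding c_def \<rho>_def by (auto simp: add_pos_nonneg)
  have "1 \<le> sqrt (1 + u\<^sup>2)" "1 \<le> sqrt (1 + 4 * u\<^sup>2)" by (auto intro!: real_le_rsqrt)
  then show "c u \<le> 1" "\<rho> u \<le> 1" unfolding c_def \<rho>_def by (auto intro: inverse_le_1_iff[THEN iffD2])
qed

private lemma \<rho>2: "\<rho> u ^ 2 * (1 + 4 * u\<^sup>2) = 1"
proof -
  have "1 + 4 * u\<^sup>2 > 0" by (simp add: add_pos_nonneg)
  then show ?thesis unfolding \<rho>_def power_inverse by simp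
qed

private lemma odd_factor: "odd_factor = (\<lambda>u. k * (3 + 4 * u\<^sup>2) - 2 * C u * \<rho> u ^ 3 + 1 / 4 * c u ^ 2)"
  by (simp add: fun_eq_iff odd_factor_def k_def C_def c_def \<rho>_def)

private lemma even_part: "even_part = (\<lambda>u. k * (C u * (1 + 4 * u\<^sup>2)) - 1 / 4 * c u - (1 - 2 * u\<^sup>2) * \<rho> u ^ 3)"
  by (simp add: fun_eq_iff even_part_def k_def C_def c_def \<rho>_def)

text \<open>
  \<open>A1\<close>, \<open>A2\<close> and \<open>E1\<close>, \<open>E2\<close> are the first two derivatives of \<open>odd_factor\<close>
  and \<open>even_part\<close>.
\<close>

private definition A1 where
  "A1 u = u * (8 * k - 2 * c u * \<rho> u ^ 3 + 24 * C u * \<rho> u ^ 5 - 1 / 2 * c u ^ 4)"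

private definition A2 where
  "A2 u = 8 * k - 2 * c u * \<rho> u ^ 3 + 2 * u\<^sup>2 * c u ^ 3 * \<rho> u ^ 3 + 48 * u\<^sup>2 * c u * \<rho> u ^ 5
     + 24 * C u * \<rho> u ^ 5 * (1 - 20 * u\<^sup>2 * \<rho> u ^ 2) - 1 / 2 * c u ^ 4 + 2 * u\<^sup>2 * c u ^ 6"

private lemma d_odd_factor: "(odd_factor has_real_derivative A1 u) (at u)"
  unfolding odd_factor A1_def
  by (rule derivative_eq_intros dC dc d\<rho> refl)+ (simp add: algebra_simps eval_nat_numeral)

private lemma d_A1: "(A1 has_real_derivative A2 u) (at u)"
  unfolding A1_def A2_def
  by (rule derivative_eq_intros dC dc d\<rho> refl)+ (simp add: algebra_simps eval_nat_numeral)

private lemma c\<rho>: "c u * \<rho> u ^ 3 \<le> 1" "c u ^ 4 \<le> 1"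
  using bounds[of u] by (auto intro!: mult_le_one power_le_one)

private lemma A1_pos: "u > 0 \<Longrightarrow> A1 u > 0"
proof -
  have "24 * C u * \<rho> u ^ 5 \<ge> 0" using bounds[of u] by auto
  then show "u > 0 \<Longrightarrow> A1 u > 0"
    using c\<rho>[of u] k_bounds unfolding A1_def mult.assoc
    by (intro mult_pos_pos) linarith+
qed

private lemma A2_pos: assumes "0 \<le> u" "u \<le> 1 / 10" shows "A2 u > 0"
proof -
  have u2: "u\<^sup>2 \<le> 1 / 100" using power_mono[of u "1/10" 2] assms by (simp add: power2_eq_square)
  have "u\<^sup>2 * \<rho> u ^ 2 \<le> 1 / 100 * 1"
    using u2 bounds[of u] by (intro mult_mono power_le_one) auto
  then have "24 * C u * \<rho> u ^ 5 * (1 - 20 * u\<^sup>2 * \<rho> u ^ 2) \<ge> 0"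
    using bounds[of u] by (intro mult_nonneg_nonneg) auto
  moreover have "2 * u\<^sup>2 * c u ^ 3 * \<rho> u ^ 3 \<ge> 0" "48 * u\<^sup>2 * c u * \<rho> u ^ 5 \<ge> 0" "2 * u\<^sup>2 * c u ^ 6 \<ge> 0"
    using bounds[of u] by auto
  moreover have "2 * c u * \<rho> u ^ 3 \<le> 2"
    using c\<rho>[of u] by (simp add: mult.assoc)
  ultimately show ?thesis
    using c\<rho>(2)[of u] k_bounds unfolding A2_def by linarith
qed

private definition E1 where
  "E1 u = u * (k * (c u * (1 + 4 * u\<^sup>2) + 8 * C u) + 1 / 4 * c u ^ 3 + 4 * \<rho> u ^ 3 + 12 * (1 - 2 * u\<^sup>2) * \<rho> u ^ 5)"

private definition E2 where
  "E2 u = k * ((c u - u\<^sup>2 * c u ^ 3) * (1 + 4 * u\<^sup>2) + 16 * u\<^sup>2 * c u + 8 * C u)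
     + 1 / 4 * (c u ^ 3 - 3 * u\<^sup>2 * c u ^ 5) + 4 * \<rho> u ^ 3 - 48 * u\<^sup>2 * \<rho> u ^ 5
     + 12 * (1 - 6 * u\<^sup>2) * \<rho> u ^ 5 - 240 * u\<^sup>2 * (1 - 2 * u\<^sup>2) * \<rho> u ^ 7"

private lemma d_even_part: "(even_part has_real_derivative E1 u) (at u)"
  unfolding even_part E1_def
  by (rule derivative_eq_intros dC dc d\<rho> refl)+ (simp add: algebra_simps eval_nat_numeral)

private lemma d_E1: "(E1 has_real_derivative E2 u) (at u)"
  unfolding E1_def E2_def
  by (rule derivative_eq_intros dC dc d\<rho> refl)+ (simp add: algebra_simps eval_nat_numeral add_divide_distrib diff_divide_distrib)

private lemma E1_pos: assumes "0 < u" "u\<^sup>2 < 1 / 2" shows "E1 u > 0"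
proof -
  have "k * (c u * (1 + 4 * u\<^sup>2) + 8 * C u) > 0" "1 / 4 * c u ^ 3 > 0" "4 * \<rho> u ^ 3 > 0"
    "12 * (1 - 2 * u\<^sup>2) * \<rho> u ^ 5 > 0"
    using bounds[of u] k_bounds assms by (auto intro!: mult_pos_pos add_pos_pos simp: add_pos_nonneg)
  then show ?thesis using assms unfolding E1_def by (intro mult_pos_pos) linarith+
qed

private lemma E2_le: assumes "0 \<le> u" "u \<le> 1 / 10" shows "E2 u \<le> 25"
proof -
  have u2: "u\<^sup>2 \<le> 1 / 100" using power_mono[of u "1/10" 2] assms by (simp add: power2_eq_square)
  have pw: "c u ^ n \<le> 1" "\<rho> u ^ n \<le> 1" "0 \<le> c u ^ n" "0 \<le> \<rho> u ^ n" for n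
    using bounds[of u] by (auto intro!: power_le_one)
  have "u\<^sup>2 * c u ^ 3 \<ge> 0" using bounds(3)[of u] by simp
  then have "c u - u\<^sup>2 * c u ^ 3 \<le> 1" using bounds(4)[of u] by linarith
  then have "(c u - u\<^sup>2 * c u ^ 3) * (1 + 4 * u\<^sup>2) \<le> 1 * (1 + 4 * u\<^sup>2)"
    by (intro mult_right_mono) auto
  moreover have "16 * (u\<^sup>2 * c u) \<le> 16 * (u\<^sup>2 * 1)"
    using bounds[of u] by (intro mult_left_mono) auto
  ultimately have "(c u - u\<^sup>2 * c u ^ 3) * (1 + 4 * u\<^sup>2) + 16 * u\<^sup>2 * c u + 8 * C u \<le> 10"
    using u2 bounds(2)[of u] by simp
  then have "k * ((c u - u\<^sup>2 * c u ^ 3) * (1 + 4 * u\<^sup>2) + 16 * u\<^sup>2 * c u + 8 * C u) \<le> k * 10"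
    using k_bounds by (intro mult_left_mono) auto
  moreover have "3 * u\<^sup>2 * c u ^ 5 \<ge> 0" "48 * u\<^sup>2 * \<rho> u ^ 5 \<ge> 0" "240 * u\<^sup>2 * (1 - 2 * u\<^sup>2) * \<rho> u ^ 7 \<ge> 0"
    using bounds(3)[of u] bounds(5)[of u] u2 by auto
  moreover have "12 * (1 - 6 * u\<^sup>2) * \<rho> u ^ 5 \<le> 12 * 1"
    using pw[of 5] u2 by (intro mult_mono) auto
  moreover have "X + 1 / 4 * (c3 - Y) + 4 * Z - P + Q - R \<le> 25"
    if "X \<le> k * 10" "0 \<le> Y" "0 \<le> P" "0 \<le> R" "Q \<le> 12 * 1" "c3 \<le> 1" "Z \<le> 1" for X Y P Q R Z c3
    using that k_bounds by (simp add: field_simps)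
  ultimately show ?thesis
    using pw(1)[of 3] pw(2)[of 3] unfolding E2_def by blast
qed

lemma odd_factor_strict_mono:
  assumes "0 \<le> u" "u < v" shows "odd_factor u < odd_factor v"
proof (rule DERIV_pos_imp_increasing_open[OF assms(2)])
  show "\<exists>y. (odd_factor has_real_derivative y) (at x) \<and> y > 0" if "u < x" "x < v" for x
    using d_odd_factor[of x] A1_pos[of x] that assms by auto
  show "continuous_on {u..v} odd_factor"
    by (meson DERIV_continuous_on DERIV_subset d_odd_factor subset_UNIV)
qed

lemma even_part_strict_mono:
  assumes "0 \<le> u" "u < v" "v\<^sup>2 \<le> 1 / 2" shows "even_part u < even_part v"
proof (rule DERIV_pos_imp_increasing_open[OF assms(2)])
  show "\<exists>y. (even_part has_real_derivative y) (at x) \<and> y > 0" if "u < x" "x < v" for x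
    using d_even_part[of x] E1_pos[of x] that assms power_strict_mono[of x v 2] by auto
  show "continuous_on {u..v} even_part"
    by (meson DERIV_continuous_on DERIV_subset d_even_part subset_UNIV)
qed

lemma continuous_on_odd_factor: "continuous_on S odd_factor"
  by (meson DERIV_continuous_on DERIV_subset d_odd_factor subset_UNIV)

lemma continuous_on_even_part: "continuous_on S even_part"
  by (meson DERIV_continuous_on DERIV_subset d_even_part subset_UNIV)

text \<open>
  The value at 0 is \<open>sqrt 3 - 7/4\<close>. That it is slightly negative is why there are noncongruent crowns with
  equal masses and why \<open>m*\<close> exceeds 1 by so little.
\<close>

lemma odd_factor_0: "odd_factor 0 < 0" "odd_factor 0 > - 1 / 50"
  using k_bounds unfolding odd_factor C_def c_def \<rho>_def by auto

private lemma bounds_10: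
  "C (1 / 10) \<le> 1005 / 1000" "99 / 100 \<le> c (1 / 10)" "98 / 100 \<le> \<rho> (1 / 10)" "\<rho> (1 / 10) \<le> 981 / 1000"
proof -
  show C: "C (1 / 10) \<le> 1005 / 1000"
    unfolding C_def by (rule real_le_lsqrt) (auto simp: power2_eq_square)
  have "inverse (1005 / 1000) \<le> inverse (C (1 / 10))"
    using C bounds(1)[of "1 / 10"] by (intro le_imp_inverse_le) auto
  then show "99 / 100 \<le> c (1 / 10)"
    unfolding c_def C_def by simp
  have r: "\<rho> (1 / 10) ^ 2 = 100 / 104"
    using \<rho>2[of "1 / 10"] by (simp add: power2_eq_square)
  show "98 / 100 \<le> \<rho> (1 / 10)"
    by (rule power2_le_imp_le) (use r bounds(5)[of "1 / 10"] in \<open>auto simp: power2_eq_square\<close>)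
  show "\<rho> (1 / 10) \<le> 981 / 1000"
    by (rule power2_le_imp_le) (use r in \<open>auto simp: power2_eq_square\<close>)
qed

lemma odd_factor_tenth: "odd_factor (1 / 10) > 0"
proof -
  have "\<rho> (1 / 10) ^ 3 \<le> (981 / 1000) ^ 3"
    using bounds_10 bounds(5)[of "1 / 10"] by (intro power_mono) auto
  also have "(981 / 1000 :: real) ^ 3 \<le> 945 / 1000" by (simp add: power3_eq_cube)
  finally have "C (1 / 10) * \<rho> (1 / 10) ^ 3 \<le> 1005 / 1000 * (945 / 1000)"
    using bounds_10 bounds[of "1 / 10"] by (intro mult_mono) auto
  moreover have "(99 / 100)\<^sup>2 \<le> c (1 / 10) ^ 2"
    using bounds_10 by (intro power_mono) auto
  moreover have "odd_factor (1 / 10) = k * (304 / 100) - 2 * (C (1 / 10) * \<rho> (1 / 10) ^ 3) + c (1 / 10) ^ 2 / 4"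
    unfolding odd_factor by (simp add: power2_eq_square)
  ultimately show ?thesis
    using k_bounds by (simp add: power2_eq_square)
qed

lemma even_part_tenth: "even_part (1 / 10) \<le> - 1 / 2"
proof -
  have "(98 / 100) ^ 3 \<le> \<rho> (1 / 10) ^ 3"
    using bounds_10 by (intro power_mono) auto
  moreover have "(941 / 1000 :: real) \<le> (98 / 100) ^ 3" by (simp add: power3_eq_cube)
  moreover have "k * C (1 / 10) \<le> 578 / 1000 * (1005 / 1000)"
    using bounds_10 bounds[of "1 / 10"] k_bounds by (intro mult_mono) auto
  moreover have "even_part (1 / 10) = (k * C (1 / 10)) * (104 / 100) - c (1 / 10) / 4 - 98 / 100 * \<rho> (1 / 10) ^ 3"
    unfolding even_part by (simp add: power2_eq_square)
  ultimately show ?thesis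
    using bounds_10(2) by simp
qed

lemma even_part_le:
  assumes "0 \<le> u" "u \<le> 1 / 10" shows "even_part u \<le> - 1 / 2"
proof (cases "u < 1 / 10")
  case True
  then show ?thesis
    using even_part_strict_mono[of u "1 / 10"] even_part_tenth assms by (simp add: power2_eq_square)
next
  case False
  then have "u = 1 / 10" using assms by simp
  then show ?thesis using even_part_tenth by (simp only:)
qed

lemma neg_odd_factor_strictly_concave:
  obtains F' F'' where
    "\<And>u. 0 < u \<Longrightarrow> u < 1 / 10 \<Longrightarrow> ((\<lambda>u. - odd_factor u) has_real_derivative F' u) (at u)"
    "\<And>u. 0 < u \<Longrightarrow> u < 1 / 10 \<Longrightarrow> (F' has_real_derivative F'' u) (at u)"
    "\<And>u. 0 < u \<Longrightarrow> u < 1 / 10 \<Longrightarrow> F'' u < 0"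
proof (rule that[of "\<lambda>u. - A1 u" "\<lambda>u. - A2 u"])
  show "- A2 u < 0" if "0 < u" "u < 1 / 10" for u
    using A2_pos[of u] that by simp
qed (rule DERIV_minus d_odd_factor d_A1)+

text \<open>
  The second derivative of \<open>- E/u\<close> is \<open>(2 u E' - 2 E - u\<^sup>2 E'')/u\<^sup>3\<close>. On \<open>(0, 1/10)\<close> one
  has \<open>E' > 0\<close>, \<open>- E \<ge> 1/2\<close> and \<open>E'' \<le> 25\<close>, so that the term \<open>- 2 E\<close> dominates.
\<close>

lemma even_part_quotient_convex:
  obtains K' K'' where
    "\<And>u. 0 < u \<Longrightarrow> u < 1 / 10 \<Longrightarrow> ((\<lambda>u. - even_part u / u) has_real_derivative K' u) (at u)"
    "\<And>u. 0 < u \<Longrightarrow> u < 1 / 10 \<Longrightarrow> (K' has_real_derivative K'' u) (at u)"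
    "\<And>u. 0 < u \<Longrightarrow> u < 1 / 10 \<Longrightarrow> K'' u \<ge> 0"
proof (rule that[of "\<lambda>u. even_part u * inverse u ^ 2 - E1 u * inverse u"
    "\<lambda>u. inverse u ^ 3 * (2 * (u * E1 u) - 2 * even_part u - u\<^sup>2 * E2 u)"])
  fix u :: real
  assume u: "0 < u" "u < 1 / 10"
  have u0: "u \<noteq> 0" using u by simp
  have di: "(inverse has_real_derivative - (inverse u ^ 2)) (at u)"
    using DERIV_inverse[OF u0] by (simp add: eval_nat_numeral)
  show "((\<lambda>u. - even_part u / u) has_real_derivative even_part u * inverse u ^ 2 - E1 u * inverse u) (at u)"
    unfolding divide_inverse
    by (rule derivative_eq_intros d_even_part di refl u0)+ simp
  have "inverse u ^ 3 * (2 * (u * E1 u) - 2 * even_part u - u\<^sup>2 * E2 u)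
      = 2 * E1 u * inverse u ^ 2 - 2 * even_part u * inverse u ^ 3 - E2 u * inverse u"
  proof -
    have i: "inverse u ^ 3 * u = inverse u ^ 2" "inverse u ^ 3 * u\<^sup>2 = inverse u"
      using u0 by (simp_all add: field_simps power2_eq_square power3_eq_cube)
    have "inverse u ^ 3 * (2 * (u * E1 u) - 2 * even_part u - u\<^sup>2 * E2 u)
        = 2 * E1 u * (inverse u ^ 3 * u) - 2 * even_part u * inverse u ^ 3 - E2 u * (inverse u ^ 3 * u\<^sup>2)"
      by (simp add: right_diff_distrib mult_ac)
    then show ?thesis unfolding i .
  qed
  then show "((\<lambda>u. even_part u * inverse u ^ 2 - E1 u * inverse u) has_real_derivative
      inverse u ^ 3 * (2 * (u * E1 u) - 2 * even_part u - u\<^sup>2 * E2 u)) (at u)"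
    by (rule ssubst) ((rule derivative_eq_intros d_even_part d_E1 di refl u0)+, simp add: power2_eq_square power3_eq_cube algebra_simps)
  have u2: "u\<^sup>2 \<le> 1 / 100" using power_mono[of u "1/10" 2] u by (simp add: power2_eq_square)
  have "u\<^sup>2 * E2 u \<le> u\<^sup>2 * 25" using E2_le[of u] u by (intro mult_left_mono) auto
  moreover have "u * E1 u \<ge> 0" using E1_pos[of u] u u2 by auto
  ultimately have "2 * (u * E1 u) - 2 * even_part u - u\<^sup>2 * E2 u \<ge> 0"
    using even_part_le[of u] u u2 by linarith
  then show "inverse u ^ 3 * (2 * (u * E1 u) - 2 * even_part u - u\<^sup>2 * E2 u) \<ge> 0"
    using u by (intro mult_nonneg_nonneg) auto
qed

end

text \<open>
  On \<open>(0, u0)\<close> the quotient \<open>u A(u) / E(u)\<close> of negative functions equals \<open>(-A) / (-E/u)\<close>; it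
  vanishes at 0 by the factor \<open>u\<close> and at \<open>u0\<close> by the factor \<open>A\<close>.
\<close>

lemma inner_level_sets:
  obtains u0 M where "0 < u0" and "u0 < 1 / 10" and "odd_factor u0 = 0" and "0 < M" and "M < 1 / 50"
    and "\<And>c. 0 < c \<Longrightarrow> c < M \<Longrightarrow> card {u\<in>{0<..<u0}. u * odd_factor u = c * even_part u} = 2"
    and "card {u\<in>{0<..<u0}. u * odd_factor u = M * even_part u} = 1"
    and "\<And>c. M < c \<Longrightarrow> {u\<in>{0<..<u0}. u * odd_factor u = c * even_part u} = {}"
proof -
  obtain u0 where u0: "0 \<le> u0" "u0 \<le> 1 / 10" "odd_factor u0 = 0"
    using IVT'[of odd_factor 0 0 "1 / 10"] odd_factor_0 odd_factor_tenth continuous_on_odd_factor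
    by (meson divide_nonneg_nonneg less_imp_le zero_le_numeral zero_le_one)
  then have "u0 \<noteq> 0" "u0 \<noteq> 1 / 10"
    using odd_factor_0 odd_factor_tenth by (metis less_irrefl)+
  with u0 have u0': "0 < u0" "u0 < 1 / 10"
    by simp_all
  define W where "W u = u * odd_factor u / even_part u" for u
  have E: "even_part u < 0" if "0 \<le> u" "u \<le> u0" for u
    using even_part_le[of u] that u0' by simp
  have A: "odd_factor u < 0" if "0 \<le> u" "u < u0" for u
    using odd_factor_strict_mono[of u u0] that u0 by simp
  have W_eq: "W u = c \<longleftrightarrow> u * odd_factor u = c * even_part u" if "u \<in> {0<..<u0}" for u c
    using E[of u] that by (auto simp: W_def field_simps)
  define K where "K = (\<lambda>u. - even_part u / u)"
  have W_K: "W u = - odd_factor u / K u" if "0 < u" for u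
    using that by (simp add: W_def K_def)
  obtain F' F'' where F12:
    "\<And>u. 0 < u \<Longrightarrow> u < 1 / 10 \<Longrightarrow> ((\<lambda>u. - odd_factor u) has_real_derivative F' u) (at u)"
    "\<And>u. 0 < u \<Longrightarrow> u < 1 / 10 \<Longrightarrow> (F' has_real_derivative F'' u) (at u)"
    "\<And>u. 0 < u \<Longrightarrow> u < 1 / 10 \<Longrightarrow> F'' u < 0"
    by (rule neg_odd_factor_strictly_concave) blast
  obtain K' K'' where K12:
    "\<And>u. 0 < u \<Longrightarrow> u < 1 / 10 \<Longrightarrow> (K has_real_derivative K' u) (at u)"
    "\<And>u. 0 < u \<Longrightarrow> u < 1 / 10 \<Longrightarrow> (K' has_real_derivative K'' u) (at u)"
    "\<And>u. 0 < u \<Longrightarrow> u < 1 / 10 \<Longrightarrow> K'' u \<ge> 0"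
    unfolding K_def by (rule even_part_quotient_convex) blast
  have quasi: "W y > min (W x) (W v)" if ord: "0 < x" "x < y" "y < v" "v < u0" for x y v
  proof -
    have "- odd_factor y / K y > min (- odd_factor x / K x) (- odd_factor v / K v)"
      by (rule quotient_strictly_quasiconcave[OF _ _ _ _ _ _ _ _ ord, where F = "\<lambda>u. - odd_factor u" and F' = F' and F'' = F'' and K' = K' and K'' = K''])
         (use F12 K12 A E u0' in \<open>auto simp: K_def divide_neg_pos\<close>)
    then show ?thesis using ord by (simp add: W_K)
  qed
  have cont: "continuous_on {0..u0} W"
    unfolding W_def using E
    by (intro continuous_intros continuous_on_odd_factor continuous_on_even_part) (auto simp: less_le)
  obtain M where M: "M > 0" "M \<in> W ` {0<..<u0}"
    "\<And>c. 0 < c \<Longrightarrow> c < M \<Longrightarrow> card {x\<in>{0<..<u0}. W x = c} = 2"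
    "card {x\<in>{0<..<u0}. W x = M} = 1" "\<And>c. M < c \<Longrightarrow> {x\<in>{0<..<u0}. W x = c} = {}"
  proof (rule level_sets_of_unimodal[of 0 u0 W])
    show "W x > 0" if "0 < x" "x < u0" for x
      using that A[of x] E[of x] by (simp add: W_def divide_neg_neg mult_pos_neg)
  qed (use u0 u0' cont quasi in \<open>auto simp: W_def\<close>)
  have sets: "{x\<in>{0<..<u0}. W x = c} = {u\<in>{0<..<u0}. u * odd_factor u = c * even_part u}" for c
    using W_eq by blast
  have "M < 1 / 50"
  proof -
    obtain u where u: "0 < u" "u < u0" "M = W u" using M(2) by auto
    have "u * (- odd_factor u) \<le> 1 / 10 * (1 / 50)"
      using odd_factor_strict_mono[of 0 u] odd_factor_0 A[of u] u u0' by (intro mult_mono) auto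
    then have "- (u * odd_factor u) < - (1 / 50 * even_part u)"
      using even_part_le[of u] u u0' by simp
    then show ?thesis
      using u E[of u] by (simp add: W_def divide_less_eq)
  qed
  with M u0 u0' show ?thesis unfolding sets by (intro that)
qed

section \<open>The symmetric parameter\<close>

text \<open>
  With \<open>w = u + C\<close>, \<open>v = C - u\<close> and \<open>C = sqrt (1 + u\<^sup>2)\<close> one has \<open>w v = 1\<close> and
  \<open>w\<^sup>2 + v\<^sup>2 = 2 + 4 u\<^sup>2\<close>. Hence the squared distance to a neighbour and the distance to the opposite body factor,
  \<open>w\<^sup>4 - w\<^sup>2 + 1 = w\<^sup>2 (1 + 4 u\<^sup>2)\<close> and \<open>1 + w\<^sup>2 = 2 w C\<close>, with even cofactors, and what
  remains to be split are the powers of \<open>w\<close> and \<open>v\<close>.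
\<close>

lemma crown_force_even_odd:
  fixes u :: real
  defines "w \<equiv> exp (arsinh u)"
  shows "w * crown_force (w\<^sup>2) = even_part u + u * odd_factor u"
proof -
  define C where "C = sqrt (1 + u\<^sup>2)"
  define v where "v = C - u"
  have C2: "C\<^sup>2 = 1 + u\<^sup>2" "C > 0" unfolding C_def by (auto simp: add_pos_nonneg)
  have "\<bar>u\<bar> < C" unfolding C_def by (rule real_less_rsqrt) simp
  then have pos: "u + C > 0" by linarith
  have w: "w = u + C"
    using pos by (simp add: w_def C_def arsinh_real_def add.commute)
  have w0: "w > 0" by (simp add: w_def)
  have wv: "w * v = 1"
    using C2 by (simp add: w v_def algebra_simps power2_eq_square)
  then have v: "inverse w = v" by (simp add: inverse_unique)
  have w2v2: "w\<^sup>2 * v\<^sup>2 = 1"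
    using wv by (metis power_mult_distrib power_one)
  have sum: "w\<^sup>2 + v\<^sup>2 = 2 + 4 * u\<^sup>2"
    using C2 by (simp add: w v_def power2_eq_square algebra_simps)
  have "w\<^sup>2 * (1 + 4 * u\<^sup>2) = w\<^sup>2 * (w\<^sup>2 + v\<^sup>2 - 1)"
    unfolding sum by simp
  also have "\<dots> = w\<^sup>2 * w\<^sup>2 + w\<^sup>2 * v\<^sup>2 - w\<^sup>2"
    by (simp add: algebra_simps)
  finally have "(w\<^sup>2)\<^sup>2 - w\<^sup>2 + 1 = w\<^sup>2 * (1 + 4 * u\<^sup>2)"
    unfolding w2v2 by (simp add: power2_eq_square)
  then have side: "inverse (sqrt ((w\<^sup>2)\<^sup>2 - w\<^sup>2 + 1)) = v * inverse (sqrt (1 + 4 * u\<^sup>2))"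
    using w0 v by (simp add: real_sqrt_mult)
  have "1 + w\<^sup>2 = w * v + w * w"
    unfolding wv by (simp add: power2_eq_square)
  also have "\<dots> = w * (2 * C)" by (simp add: w v_def algebra_simps)
  finally have "1 + w\<^sup>2 = w * (2 * C)" .
  then have opp: "inverse (1 + w\<^sup>2) = v * (inverse C / 2)"
    using v by simp
  define \<rho> where "\<rho> = inverse (sqrt (1 + 4 * u\<^sup>2))"
  define c where "c = inverse C"
  have Cc: "C * c = 1" using C2 by (simp add: c_def)
  define k where "k = 1 / sqrt 3"
  \<comment> \<open>\<open>w v = 1\<close> lowers the degree, leaving \<open>2 - v\<^sup>2\<close> and \<open>v\<close>\<close>
  have 1: "w * (2 * w\<^sup>2 - 1) * v ^ 3 = 2 * (w * v) ^ 3 - (w * v) * v\<^sup>2"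
    by (simp add: power2_eq_square power3_eq_cube algebra_simps)
  have 2: "w * v\<^sup>2 = v" using wv by (simp add: power2_eq_square mult.assoc[symmetric])
  have "w * crown_force (w\<^sup>2) = w * (w\<^sup>2 * k - (2 * w\<^sup>2 - 1) * (v * \<rho>) ^ 3 - (v * (c / 2))\<^sup>2)"
    unfolding crown_force_def side opp \<rho>_def c_def k_def by simp
  also have "\<dots> = k * w ^ 3 - (w * (2 * w\<^sup>2 - 1) * v ^ 3) * \<rho> ^ 3 - (w * v\<^sup>2) * (c\<^sup>2 * (1 / 4))"
    by (simp add: power2_eq_square power3_eq_cube algebra_simps)
  also have "\<dots> = k * w ^ 3 - (2 - v\<^sup>2) * \<rho> ^ 3 - v * (c\<^sup>2 * (1 / 4))"
    unfolding 1 2 wv by simp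
  also have "w ^ 3 = C * (C\<^sup>2 + 3 * u\<^sup>2) + u * (3 * C\<^sup>2 + u\<^sup>2)"
    by (simp add: w power2_eq_square power3_eq_cube algebra_simps)
  also have "2 - v\<^sup>2 = (2 - C\<^sup>2 - u\<^sup>2) + 2 * u * C"
    by (simp add: v_def power2_eq_square algebra_simps)
  also have "v * (c\<^sup>2 * (1 / 4)) = (C * c) * c * (1 / 4) - u * c\<^sup>2 * (1 / 4)"
    by (simp add: v_def power2_eq_square algebra_simps diff_divide_distrib)
  also have "k * (C * (C\<^sup>2 + 3 * u\<^sup>2) + u * (3 * C\<^sup>2 + u\<^sup>2)) - (2 - C\<^sup>2 - u\<^sup>2 + 2 * u * C) * \<rho> ^ 3
      - (C * c * c * (1 / 4) - u * c\<^sup>2 * (1 / 4))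
    = (k * (C * (1 + 4 * u\<^sup>2)) - c * (1 / 4) - (1 - 2 * u\<^sup>2) * \<rho> ^ 3)
      + u * (k * (3 + 4 * u\<^sup>2) - 2 * C * \<rho> ^ 3 + c\<^sup>2 * (1 / 4))"
    unfolding Cc C2(1) by (simp add: algebra_simps)
  also have "\<dots> = even_part u + u * odd_factor u"
    unfolding even_part_def odd_factor_def k_def c_def \<rho>_def C_def by simp
  finally show ?thesis .
qed

lemma even_part_minus: "even_part (- u) = even_part u" and odd_factor_minus: "odd_factor (- u) = odd_factor u"
  by (simp_all add: even_part_def odd_factor_def)

text \<open>
  This parameter turns the inversion \<open>a \<mapsto> 1/a\<close> of radii into \<open>u \<mapsto> - u\<close>.
\<close>

definition radius :: "real \<Rightarrow> real" where
  "radius u = exp (2 * arsinh u)"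

lemma radius_square: "radius u = (exp (arsinh u))\<^sup>2"
  by (simp add: radius_def exp_double)

lemma radius_pos: "radius u > 0"
  by (simp add: radius_def)

lemma radius_0: "radius 0 = 1"
  by (simp add: radius_def)

lemma radius_minus: "radius (- u) = 1 / radius u"
  by (simp add: radius_def arsinh_minus_real exp_minus inverse_eq_divide)

lemma radius_less_iff: "radius u < radius v \<longleftrightarrow> u < v"
  by (simp add: radius_def)

lemma radius_surj: "a > 0 \<Longrightarrow> \<exists>u. radius u = a"
  by (rule exI[of _ "sinh (ln a / 2)"]) (simp add: radius_def arsinh_sinh_real)

text \<open>
  After multiplication by suitable powers of \<open>sqrt a\<close> the equation is
  \<open>E + u A = m (E - u A)\<close>.
\<close>

lemma crown_equation_radius:
  "radius u * crown_force (radius u) = m * crown_force (1 / radius u)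
    \<longleftrightarrow> (m + 1) * (u * odd_factor u) = (m - 1) * even_part u"
proof -
  define w where "w = exp (arsinh u)"
  have w: "w > 0" "radius u = w\<^sup>2" by (simp_all add: w_def radius_square)
  have w': "1 / radius u = (inverse w)\<^sup>2" "exp (arsinh (- u)) = inverse w"
    by (simp_all add: w power_inverse inverse_eq_divide w_def arsinh_minus_real exp_minus power_one_over)
  have plus: "w * crown_force (w\<^sup>2) = even_part u + u * odd_factor u"
    unfolding w_def by (rule crown_force_even_odd)
  have minus: "inverse w * crown_force ((inverse w)\<^sup>2) = even_part u - u * odd_factor u"
    using crown_force_even_odd[of "- u"] unfolding w'(2) even_part_minus odd_factor_minus by simp
  have "radius u * crown_force (radius u) - m * crown_force (1 / radius u)
    = w * (w * crown_force (w\<^sup>2) - m * (inverse w * crown_force ((inverse w)\<^sup>2)))"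
    unfolding w(2) w'(1)[unfolded w(2)] using w(1)
    by (simp add: right_diff_distrib power2_eq_square)
  also have "\<dots> = w * ((m + 1) * (u * odd_factor u) - (m - 1) * even_part u)"
    unfolding plus minus by (simp add: algebra_simps)
  finally show ?thesis using w(1) by (metis eq_iff_diff_eq_0 less_irrefl mult_eq_0_iff)
qed

text \<open>
  For \<open>m \<noteq> 1\<close> the partner \<open>(1/a, 1/m)\<close> has another mass ratio, so every class contains a single
  crown of mass ratio \<open>m\<close>.
\<close>

lemma num_different_crowns_eq_card:
  assumes "m > 1"
  shows "num_different_crowns n m = card (admissible_values n m)"
proof -
  have m: "1 / m \<noteq> m" using assms by (auto simp: field_simps)
      (metis less_1_mult less_irrefl)
  have cls: "same_crown `` {(a, m)} = {(a, m), (1 / a, 1 / m)}" for a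
    by (auto simp: same_crown_def)
  have "((\<lambda>a. (a, m)) ` admissible_values n m) // same_crown
      = (\<lambda>a. {(a, m), (1 / a, 1 / m)}) ` admissible_values n m"
    by (auto simp: quotient_def cls)
  moreover have "inj (\<lambda>a::real. {(a, m), (1 / a, 1 / m)})"
    using m by (auto simp: inj_def doubleton_eq_iff)
  ultimately show ?thesis
    by (simp add: num_different_crowns_def card_image inj_on_subset)
qed

lemma num_different_crowns_1:
  assumes "admissible_values n 1 = {1, x, 1 / x}" "x > 1"
  shows "num_different_crowns n 1 = 2"
proof -
  have cls: "same_crown `` {(a, 1)} = {(a, 1), (1 / a, 1)}" for a
    by (auto simp: same_crown_def)
  have "((\<lambda>a. (a, 1)) ` admissible_values n 1) // same_crown = {{(1, 1)}, {(x, 1), (1 / x, 1)}}"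
    unfolding assms(1) by (auto simp: quotient_def cls)
  moreover have "{(1, 1)} \<noteq> {(x, 1), (1 / x, 1 :: real)}"
    using assms(2) by auto
  ultimately show ?thesis
    by (simp add: num_different_crowns_def)
qed

section \<open>Signs of the force and ranges of admissible values\<close>

text \<open>
  Sign changes on \<open>[1/10, 1/2]\<close> and on \<open>[1, 2]\<close> already account for both zeros; elsewhere the sign
  is constant by the intermediate value theorem. The bounds imply \<open>z1 < 1/z2\<close> and \<open>z2 < 1/z1\<close>,
  so the points \<open>z1, 1/z2, 1, z2, 1/z1\<close> are in increasing order.
\<close>

lemma crown_force_signs:
  assumes zeros: "{a. a > 0 \<and> Fn 3 a = 0} = {z1, z2}" and "z1 < z2"
  shows "0 < z1" "z1 < 1 / 2" "1 < z2" "z2 < 2" "crown_force z1 = 0" "crown_force z2 = 0"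
    and "\<And>a. 0 < a \<Longrightarrow> a < z1 \<Longrightarrow> crown_force a > 0"
    and "\<And>a. z1 < a \<Longrightarrow> a < z2 \<Longrightarrow> crown_force a < 0"
    and "\<And>a. z2 < a \<Longrightarrow> crown_force a > 0"
proof -
  have zero_iff: "crown_force a = 0 \<longleftrightarrow> a = z1 \<or> a = z2" if "a > 0" for a
    using zeros[unfolded set_eq_iff, rule_format, of a] that by (simp add: Fn_3)
  have "z1 \<in> {z1, z2}" "z2 \<in> {z1, z2}" by auto
  then have z_pos: "z1 > 0" "z2 > 0" and z0: "crown_force z1 = 0" "crown_force z2 = 0"
    unfolding zeros[symmetric] by (auto simp: Fn_3)
  have crossing: "\<exists>z. x \<le> z \<and> z \<le> y \<and> (z = z1 \<or> z = z2)"
    if "0 < x" "x \<le> y" "crown_force x \<le> 0 \<and> crown_force y \<ge> 0 \<or> crown_force x \<ge> 0 \<and> crown_force y \<le> 0" for x y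
  proof -
    have "continuous_on {x..y} crown_force"
      using continuous_on_crown_force by (rule continuous_on_subset) (use that in auto)
    then have "\<exists>z. x \<le> z \<and> z \<le> y \<and> crown_force z = 0"
      using that(3)
    proof (elim disjE conjE)
      assume "crown_force x \<le> 0" "0 \<le> crown_force y" "continuous_on {x..y} crown_force"
      then show ?thesis using IVT'[of crown_force x 0 y] that(2) by simp
    next
      assume "0 \<le> crown_force x" "crown_force y \<le> 0" "continuous_on {x..y} crown_force"
      then show ?thesis using IVT2'[of crown_force y 0 x] that(2) by simp
    qed
    then obtain z where z: "x \<le> z" "z \<le> y" "crown_force z = 0"
      by (elim exE conjE)
    then have "z = z1 \<or> z = z2" using zero_iff[of z] that(1) by simp
    with z show ?thesis by blast
  qed
  define k where "k = 1 / sqrt 3"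
  have k: "577 / 1000 \<le> k" "k \<le> 578 / 1000"
    unfolding k_def by (rule inv_sqrt_3_ge inv_sqrt_3_le)+
  have at_tenth: "crown_force (1 / 10) > 0"
  proof -
    have "1 \<le> inverse (sqrt ((1 / 10)\<^sup>2 - 1 / 10 + 1 :: real))"
      by (subst one_le_inverse_iff) (auto simp: power2_eq_square)
    then have "1 \<le> inverse (sqrt ((1 / 10)\<^sup>2 - 1 / 10 + 1 :: real)) ^ 3"
      by (rule one_le_power)
    moreover have "crown_force (1 / 10)
      = 1 / 10 * k + 8 / 10 * inverse (sqrt ((1 / 10)\<^sup>2 - 1 / 10 + 1)) ^ 3 - 100 / 121"
      by (simp add: crown_force_def k_def power2_eq_square)
    ultimately show ?thesis using k by simp
  qed
  have at_half: "crown_force (1 / 2) < 0"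
    using k by (simp add: crown_force_def k_def power2_eq_square)
  have at_1: "crown_force 1 < 0"
    using k by (simp add: crown_force_def k_def power2_eq_square)
  have at_2: "crown_force 2 > 0"
  proof -
    have "inverse (sqrt 3) ^ 3 = k / 3"
      by (simp add: k_def power3_eq_cube inverse_eq_divide)
    then have "crown_force 2 = k - 1 / 9"
      by (simp add: crown_force_def k_def power2_eq_square)
    then show ?thesis using k by simp
  qed
  obtain x1 where x1: "1 / 10 \<le> x1" "x1 \<le> 1 / 2" "x1 = z1 \<or> x1 = z2"
    using crossing[of "1 / 10" "1 / 2"] at_tenth at_half by auto
  obtain x2 where x2: "1 \<le> x2" "x2 \<le> 2" "x2 = z1 \<or> x2 = z2"
    using crossing[of 1 2] at_1 at_2 by auto
  have "x1 = z1" "x2 = z2"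
    using x1 x2 \<open>z1 < z2\<close> by auto
  moreover have "x1 \<noteq> 1 / 10" "x1 \<noteq> 1 / 2" "x2 \<noteq> 1" "x2 \<noteq> 2"
  proof -
    have "crown_force x1 = 0" "crown_force x2 = 0"
      using x1(3) x2(3) z0 by auto
    then show "x1 \<noteq> 1 / 10" "x1 \<noteq> 1 / 2" "x2 \<noteq> 1" "x2 \<noteq> 2"
      using at_tenth at_half at_1 at_2 by (metis less_irrefl)+
  qed
  ultimately have z: "1 / 10 < z1" "z1 < 1 / 2" "1 < z2" "z2 < 2"
    using x1 x2 by auto
  then show "z1 < 1 / 2" "1 < z2" "z2 < 2" by auto
  show "0 < z1" "crown_force z1 = 0" "crown_force z2 = 0" by fact+
  show "crown_force a > 0" if "0 < a" "a < z1" for a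
  proof (rule ccontr)
    assume "\<not> crown_force a > 0"
    then have "\<exists>y. min a (1 / 10) \<le> y \<and> y \<le> max a (1 / 10) \<and> (y = z1 \<or> y = z2)"
      using crossing[of "min a (1 / 10)" "max a (1 / 10)"] at_tenth that(1) by (auto simp: min_def max_def)
    then show False using that(2) z \<open>z1 < z2\<close> by auto
  qed
  show "crown_force a < 0" if "z1 < a" "a < z2" for a
  proof (rule ccontr)
    assume "\<not> crown_force a < 0"
    then have "\<exists>y. min a 1 \<le> y \<and> y \<le> max a 1 \<and> (y = z1 \<or> y = z2)"
      using crossing[of "min a 1" "max a 1"] at_1 that(1) z(1) by (auto simp: min_def max_def)
    then show False using that z by auto
  qed
  show "crown_force a > 0" if "z2 < a" for a
  proof (rule ccontr)
    assume "\<not> crown_force a > 0"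
    then have "\<exists>y. min a 2 \<le> y \<and> y \<le> max a 2 \<and> (y = z1 \<or> y = z2)"
      using crossing[of "min a 2" "max a 2"] at_2 that z(3) by (auto simp: min_def max_def)
    then show False using that z \<open>z1 < z2\<close> by auto
  qed
qed

text \<open>
  The points \<open>z1\<close>, \<open>z2\<close> and their inverses divide the half-line; in the ranges not listed
  \<open>f(a)\<close> and \<open>f(1/a)\<close> have opposite signs, or one of them vanishes alone, or
  \<open>a f(a) / f(1/a) < 20/21\<close>.
\<close>

lemma admissible_values_cases:
  assumes zeros: "{a. a > 0 \<and> Fn 3 a = 0} = {z1, z2}" and "z1 < z2" and "m \<ge> 1"
    and a: "a \<in> admissible_values 3 m"
  shows "a \<in> {1 / z2<..<1} \<or> a = 1 \<and> m = 1 \<or> a \<in> {1<..<z2} \<or> a \<in> {1 / z1<..}"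
proof -
  note s = crown_force_signs[OF zeros \<open>z1 < z2\<close>]
  have a0: "a > 0" and eq: "a * crown_force a = m * crown_force (1 / a)"
    using a by (auto simp: admissible_values_def twisted_crown_3_iff)
  have inv: "1 / a < z \<longleftrightarrow> 1 / z < a" "z < 1 / a \<longleftrightarrow> a < 1 / z" if "z > 0" for z
    using that a0 by (auto simp: field_simps)
  have z2': "1 / 2 < 1 / z2" "1 / z2 < 1" and z1': "2 < 1 / z1"
    using s(1-4) by (auto simp: field_simps)
  consider "a < z1" | "a = z1" | "z1 < a" "a \<le> 1 / z2" | "1 / z2 < a" "a < z2" | "z2 \<le> a" "a \<le> 1 / z1" | "1 / z1 < a"
    by linarith
  then show ?thesis
  proof cases
    \<comment> \<open>the inverse exceeds \<open>z2\<close>, so both forces are positive and their ratio is bounded\<close>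
    case 1
    have "1 / a > z2" using inv(2)[of z2] 1 s z2' by auto
    then have "crown_force (1 / a) > 0" by (rule s)
    moreover have "a * (21 * (a * crown_force a)) < a * (20 * crown_force (1 / a))"
      using outer_quotient_bound[OF a0] 1 s(2) by (simp add: power2_eq_square mult_ac)
    then have "21 * (a * crown_force a) < 20 * crown_force (1 / a)"
      using a0 by simp
    ultimately have "21 * m < 20"
      unfolding eq by (simp add: mult.assoc[symmetric])
    then show ?thesis using \<open>m \<ge> 1\<close> by simp
  next
    case 2
    then have "crown_force (1 / a) > 0" using s(9)[of "1 / a"] z1' s(4) by simp
    then show ?thesis using eq 2 s(5) \<open>m \<ge> 1\<close> by simp
  next
    case 3
    then have "crown_force (1 / a) \<ge> 0"
      using s(9)[of "1 / a"] s(6) inv(2)[of z2] s(3) by (cases "a = 1 / z2") auto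
    then have "a * crown_force a \<ge> 0" unfolding eq using \<open>m \<ge> 1\<close> by simp
    moreover have "crown_force a < 0" using s(8)[of a] 3 z2' s(3) by simp
    ultimately show ?thesis using a0 by (simp add: zero_le_mult_iff)
  next
    case 4
    show ?thesis
    proof (cases "a = 1")
      case True
      then have "crown_force 1 = m * crown_force 1" using eq by simp
      moreover have "crown_force 1 < 0" using s(8)[of 1] s(2,3) by simp
      ultimately show ?thesis using True by simp
    qed (use 4 in auto)
  next
    case 5
    then have "crown_force a \<ge> 0" using s(9)[of a] s(6) by (cases "a = z2") auto
    then have "m * crown_force (1 / a) \<ge> 0" unfolding eq[symmetric] using a0 by simp
    then have p: "crown_force (1 / a) \<ge> 0" using \<open>m \<ge> 1\<close> by (simp add: zero_le_mult_iff)
    have "1 / a < z2" using inv(1)[of z2] 5 z2' s(3) by simp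
    then have "\<not> z1 < 1 / a" using p s(8)[of "1 / a"] by force
    then have "a = 1 / z1" using inv(2)[of z1] 5 s(1) by simp
    then have "a * crown_force a = 0" using eq s(5) by simp
    then show ?thesis using s(9)[of a] \<open>a = 1 / z1\<close> z1' s(4) a0 by simp
  qed auto
qed

lemma admissible_reciprocal_image:
  assumes "z1 > 0" and "m > 0"
  shows "admissible_values 3 m \<inter> {1 / z1<..}
    = (\<lambda>b. 1 / b) ` {b\<in>{0<..<z1}. b * crown_force b = 1 / m * crown_force (1 / b)}" (is "?L = ?R")
proof -
  have swap: "1 / b * x = m * y \<longleftrightarrow> b * y = 1 / m * x" if "b > 0" for b x y
    using that \<open>m > 0\<close> by (auto simp: field_simps)
  have iff: "1 / b \<in> admissible_values 3 m \<longleftrightarrow> b * crown_force b = 1 / m * crown_force (1 / b)" if "b > 0" for b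
    unfolding swap[OF that, symmetric] using that \<open>m > 0\<close>
    by (simp add: admissible_values_def twisted_crown_3_iff)
  have "a \<in> ?R" if "a \<in> ?L" for a
  proof (rule image_eqI[of _ _ "1 / a"])
    have a: "a > 1 / z1" "a > 0" using that assms by (auto simp: admissible_values_def twisted_crown_def)
    then show "1 / a \<in> {b\<in>{0<..<z1}. b * crown_force b = 1 / m * crown_force (1 / b)}"
      using iff[of "1 / a"] that \<open>z1 > 0\<close> by (auto simp: pos_divide_less_eq mult.commute)
  qed simp
  moreover have "1 / b \<in> ?L" if "b \<in> {b\<in>{0<..<z1}. b * crown_force b = 1 / m * crown_force (1 / b)}" for b
    using iff[of b] that \<open>z1 > 0\<close> by (auto simp: frac_less2)
  ultimately show ?thesis by blast
qed

lemma radius_mem_admissible_iff: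
  assumes "m > 0"
  shows "radius u \<in> admissible_values 3 m \<longleftrightarrow> (m + 1) * (u * odd_factor u) = (m - 1) * even_part u"
  using assms by (simp add: admissible_values_def twisted_crown_3_iff radius_pos crown_equation_radius)

lemma admissible_radius_image:
  assumes "m > 0"
  shows "admissible_values 3 m \<inter> {radius p<..<radius q}
    = radius ` {u\<in>{p<..<q}. (m + 1) * (u * odd_factor u) = (m - 1) * even_part u}" (is "?L = ?R")
proof
  show "?L \<subseteq> ?R"
  proof
    fix a assume a: "a \<in> ?L"
    then have "a > 0" by (simp add: admissible_values_def twisted_crown_def)
    then obtain u where "a = radius u" using radius_surj by blast
    then show "a \<in> ?R" using a assms by (auto simp: radius_less_iff radius_mem_admissible_iff)
  qed
  show "?R \<subseteq> ?L"
    using assms by (auto simp: radius_less_iff radius_mem_admissible_iff)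
qed

lemma card_radius_image: "card (radius ` S) = card S"
proof -
  have "inj_on radius S"
    using radius_less_iff by (intro inj_onI) (metis linorder_less_linear order_less_irrefl)
  then show ?thesis by (rule card_image)
qed

section \<open>Counting crowns\<close>

text \<open>
  This is the equation at \<open>- v\<close>, for radii between \<open>1/z2\<close> and 1. A solution needs
  \<open>A(v) \<ge> 0\<close>, so \<open>v \<ge> u0\<close>, and from there on both \<open>v A(v)\<close> and \<open>E(v)\<close> increase. At the
  parameter \<open>t\<close> of \<open>z2\<close> the force \<open>E + t A\<close> vanishes, which makes the left hand side exceed the right
  one.
\<close>

lemma reflected_equation_unique:
  assumes m: "m \<ge> 1" and u0: "0 < u0" "odd_factor u0 = 0"
    and t: "u0 < t" "t\<^sup>2 \<le> 1 / 2" "even_part t + t * odd_factor t = 0"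
  obtains v where "u0 \<le> v" and "v < t"
    and "{v\<in>{0<..<t}. (m + 1) * (v * odd_factor v) = (1 - m) * even_part v} = {v}"
proof -
  define h where "h v = (m + 1) * (v * odd_factor v) + (m - 1) * even_part v" for v
  have At: "odd_factor t > 0"
    using odd_factor_strict_mono[of u0 t] u0 t by simp
  then have "t * odd_factor t > 0" using u0 t by simp
  then have Et: "even_part t < 0" using t(3) by linarith
  have mono: "h v < h v'" if "u0 \<le> v" "v < v'" "v' \<le> t" for v v'
  proof -
    have A: "odd_factor v \<ge> 0"
      using odd_factor_strict_mono[of u0 v] u0 that by (cases "v = u0") auto
    have "v * odd_factor v < v' * odd_factor v'"
    proof -
      have "v * odd_factor v \<le> v' * odd_factor v" using that A by (intro mult_right_mono) auto
      also have "\<dots> < v' * odd_factor v'"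
        using odd_factor_strict_mono[of v v'] that u0 by simp
      finally show ?thesis .
    qed
    then have "(m + 1) * (v * odd_factor v) < (m + 1) * (v' * odd_factor v')"
      using m by simp
    moreover have "v'\<^sup>2 \<le> t\<^sup>2" using that u0 by (intro power_mono) auto
    then have "even_part v < even_part v'"
      using that u0 order_trans[OF _ t(2)] by (intro even_part_strict_mono) auto
    then have "(m - 1) * even_part v \<le> (m - 1) * even_part v'"
      using m by (intro mult_left_mono) auto
    ultimately show ?thesis unfolding h_def by linarith
  qed
  have neg: "even_part v < 0" if "0 \<le> v" "v \<le> t" for v
    using even_part_strict_mono[of v t] that t(2) Et by (cases "v = t") auto
  have "h u0 \<le> 0"
    using neg[of u0] u0 t m by (simp add: h_def mult_nonneg_nonpos)
  moreover have "h t = 2 * (t * odd_factor t)"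
    using t(3) unfolding h_def eq_neg_iff_add_eq_0[symmetric] by (simp add: algebra_simps)
  then have ht: "h t > 0"
    using \<open>t * odd_factor t > 0\<close> by simp
  moreover have "continuous_on {u0..t} h"
    unfolding h_def by (intro continuous_intros continuous_on_odd_factor continuous_on_even_part)
  ultimately obtain v where v: "u0 \<le> v" "v \<le> t" "h v = 0"
    using IVT'[of h u0 0 t] t(1) by auto
  then have "v < t" using ht by (cases "v = t") auto
  have h_iff: "(m + 1) * (v * odd_factor v) = (1 - m) * even_part v \<longleftrightarrow> h v = 0" for v
    unfolding h_def by (auto simp: algebra_simps)
  have uniq: "x = v" if x: "0 < x" "x < t" "h x = 0" for x
  proof -
    have "(m - 1) * even_part x \<le> 0"
      using neg[of x] x m by (intro mult_nonneg_nonpos) auto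
    then have "(m + 1) * (x * odd_factor x) \<ge> 0"
      using x(3) unfolding h_def by linarith
    then have "odd_factor x \<ge> 0"
      using x m by (simp add: zero_le_mult_iff)
    then have "u0 \<le> x"
      using odd_factor_strict_mono[of x u0] x u0 by (cases "u0 \<le> x") auto
    then show ?thesis
      using mono[of x v] mono[of v x] v x by (cases rule: linorder_cases[of x v]) auto
  qed
  have "{v\<in>{0<..<t}. (m + 1) * (v * odd_factor v) = (1 - m) * even_part v} = {v}"
    unfolding h_iff using uniq v u0 \<open>v < t\<close> by auto
  with v \<open>v < t\<close> show ?thesis by (intro that)
qed

theorem theorem2:
  fixes z1 z2 :: real
  assumes "{a. a > 0 \<and> Fn 3 a = 0} = {z1, z2}" and "z1 < z2"
  shows "(\<forall>m\<ge>1. \<exists>a. twisted_crown 3 a m) \<and>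
    (\<exists>ms mss. 1 < ms \<and> 1 < mss \<and> ms < mss \<and>
      (\<forall>m\<in>{1<..<ms}. num_different_crowns 3 m = 3 \<and>
         admissible_values 3 m \<subseteq> {1 / z2<..<z2}) \<and>
      (\<forall>m\<in>{mss<..}. num_different_crowns 3 m = 3 \<and>
         card (admissible_values 3 m \<inter> {1 / z2<..<1}) = 1 \<and>
         card (admissible_values 3 m \<inter> {1 / z1<..}) = 2) \<and>
      (\<forall>m\<in>{ms<..<mss}. num_different_crowns 3 m = 1 \<and>
         admissible_values 3 m \<subseteq> {1 / z2<..<1}) \<and>
      (\<forall>m\<in>{1, ms, mss}. num_different_crowns 3 m = 2))"
proof -
  note s = crown_force_signs[OF assms]
  obtain u0 M where u0: "0 < u0" "u0 < 1 / 10" "odd_factor u0 = 0" and M: "0 < M" "M < 1 / 50"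
    "\<And>c. 0 < c \<Longrightarrow> c < M \<Longrightarrow> card {u\<in>{0<..<u0}. u * odd_factor u = c * even_part u} = 2"
    "card {u\<in>{0<..<u0}. u * odd_factor u = M * even_part u} = 1"
    "\<And>c. M < c \<Longrightarrow> {u\<in>{0<..<u0}. u * odd_factor u = c * even_part u} = {}"
    by (rule inner_level_sets) blast
  have z2': "1 / 2 < 1 / z2" "1 / z2 < 1" and z1': "2 < 1 / z1"
    using s(1-4) by (auto simp: field_simps)
  obtain L where L: "0 < L" "L < 20 / 21"
    "\<And>c. 0 < c \<Longrightarrow> c < L \<Longrightarrow> card {b\<in>{0<..<z1}. b * crown_force b = c * crown_force (1 / b)} = 2"
    "card {b\<in>{0<..<z1}. b * crown_force b = L * crown_force (1 / b)} = 1"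
    "\<And>c. L < c \<Longrightarrow> {b\<in>{0<..<z1}. b * crown_force b = c * crown_force (1 / b)} = {}"
  proof (rule outer_level_sets[of z1])
    show "crown_force (1 / b) > 0" if "0 < b" "b \<le> z1" for b
    proof (rule s(9))
      have "1 / z1 \<le> 1 / b" using that by (intro divide_left_mono) auto
      then show "z2 < 1 / b" using s(4) z1' by linarith
    qed
  qed (use s in auto)
  obtain t where t: "radius t = z2"
    using radius_surj[of z2] s(3) by auto
  have radius_mt: "radius (- t) = 1 / z2"
    by (simp add: radius_minus t)
  have t0: "t > 0"
    using radius_less_iff[of 0 t] s(3) by (simp add: t radius_0)
  \<comment> \<open>\<open>t\<close> is \<open>(sqrt z2 - 1 / sqrt z2) / 2\<close>, hence at most \<open>sqrt z2 / 2\<close>\<close>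
  have t2: "t\<^sup>2 \<le> 1 / 2"
  proof -
    define y where "y = exp (arsinh t)"
    have y: "y\<^sup>2 = z2" using t by (simp add: radius_square y_def)
    have "y > 1" using t0 by (simp add: y_def)
    have "t = sinh (arsinh t)" by simp
    also have "\<dots> = (y - inverse y) / 2" by (simp add: sinh_field_def y_def exp_minus)
    finally have "t\<^sup>2 \<le> (y / 2)\<^sup>2"
      using \<open>y > 1\<close> t0 by (intro power_mono) auto
    then show ?thesis using y s(4) by (simp add: power_divide)
  qed
  have sqrt_force: "even_part t + t * odd_factor t = 0"
    using crown_force_even_odd[of t] s(6) by (simp add: radius_square[symmetric] t)
  \<comment> \<open>twice this is the difference of the forces at the radii \<open>z2\<close> and \<open>1/z2\<close>, each times the square root of its radius\<close>
  have At: "t * odd_factor t > 0"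
  proof -
    have "crown_force (radius (- t)) < 0"
      unfolding radius_mt by (rule s(8)) (use s(2,3) z2' in linarith)+
    then have "exp (arsinh (- t)) * crown_force (radius (- t)) < 0"
      by (intro mult_pos_neg) auto
    then have "even_part t - t * odd_factor t < 0"
      unfolding radius_square crown_force_even_odd even_part_minus odd_factor_minus by simp
    then show ?thesis using sqrt_force by linarith
  qed
  \<comment> \<open>at \<open>t\<close> the even factor \<open>odd_factor\<close> is already positive\<close>
  have u0t: "u0 < t"
  proof (rule ccontr)
    assume "\<not> u0 < t"
    then have "odd_factor t \<le> 0"
      using odd_factor_strict_mono[of t u0] t0 u0 by (cases "t = u0") auto
    then show False using At t0 by (simp add: zero_less_mult_iff)
  qed
  have E_neg: "even_part u < 0" if "0 \<le> u" "u \<le> t" for u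
    using even_part_strict_mono[of u t] that t2 At sqrt_force by (cases "u = t") auto

  \<comment> \<open>every admissible value other than 1 lies in one of these three ranges\<close>
  define lower where "lower m = admissible_values 3 m \<inter> {1 / z2<..<1}" for m
  define upper where "upper m = admissible_values 3 m \<inter> {1<..<z2}" for m
  define outer where "outer m = admissible_values 3 m \<inter> {1 / z1<..}" for m
  have lower: "\<exists>v. u0 \<le> v \<and> v < t \<and> lower m = {1 / radius v} \<and> (m = 1 \<longrightarrow> v = u0)" if m: "m \<ge> 1" for m
  proof -
    obtain v where v: "u0 \<le> v" "v < t"
      "{v\<in>{0<..<t}. (m + 1) * (v * odd_factor v) = (1 - m) * even_part v} = {v}"
      by (rule reflected_equation_unique[OF m u0(1,3) u0t t2 sqrt_force])
    have "lower m = radius ` {u\<in>{- t<..<0}. (m + 1) * (u * odd_factor u) = (m - 1) * even_part u}"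
      using admissible_radius_image[of m "- t" 0] m by (simp add: lower_def radius_mt radius_0)
    also have "{u\<in>{- t<..<0}. (m + 1) * (u * odd_factor u) = (m - 1) * even_part u}
      = uminus ` {v\<in>{0<..<t}. (m + 1) * (v * odd_factor v) = (1 - m) * even_part v}" (is "?A = uminus ` ?B")
    proof (intro set_eqI iffI)
      have iff: "(m + 1) * (- u * odd_factor (- u)) = (m - 1) * even_part (- u)
          \<longleftrightarrow> (m + 1) * (u * odd_factor u) = (1 - m) * even_part u" for u
        unfolding odd_factor_minus even_part_minus by (auto simp: algebra_simps)
      show "u \<in> uminus ` ?B" if "u \<in> ?A" for u
        using iff[of "- u"] that by (intro image_eqI[of _ _ "- u"]) auto
      show "u \<in> ?A" if "u \<in> uminus ` ?B" for u
        using that iff by auto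
    qed
    finally have "lower m = {1 / radius v}"
      unfolding v(3) by (simp add: radius_minus)
    moreover have "v = u0" if "m = 1"
    proof -
      have "u0 \<in> {v\<in>{0<..<t}. (m + 1) * (v * odd_factor v) = (1 - m) * even_part v}"
        using u0 u0t that by simp
      then show ?thesis unfolding v(3) by simp
    qed
    ultimately show ?thesis using v by blast
  qed
  have upper_image: "upper m = radius ` {u\<in>{0<..<t}. (m + 1) * (u * odd_factor u) = (m - 1) * even_part u}"
    if "m \<ge> 1" for m
    using admissible_radius_image[of m 0 t] that by (simp add: upper_def t radius_0)
  have upper_1: "upper 1 = {radius u0}"
  proof -
    have "u = u0" if "0 < u" "odd_factor u = 0" for u
      using odd_factor_strict_mono[of u u0] odd_factor_strict_mono[of u0 u] that u0
      by (cases rule: linorder_cases[of u u0]) auto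
    moreover have "(1 + 1) * (u * odd_factor u) = (1 - 1) * even_part u \<longleftrightarrow> odd_factor u = 0" if "0 < u" for u
      using that by simp
    ultimately have "{u\<in>{0<..<t}. (1 + 1) * (u * odd_factor u) = (1 - 1) * even_part u} = {u0}"
      using u0(1,3) u0t by (intro set_eqI) (metis (mono_tags, lifting) greaterThanLessThan_iff mem_Collect_eq singleton_iff)
    then show ?thesis unfolding upper_image[OF order_refl] by (simp only: image_insert image_empty)
  qed
  have upper_set: "upper m = radius ` {u\<in>{0<..<u0}. u * odd_factor u = (m - 1) / (m + 1) * even_part u}"
    if m: "m > 1" for m
  proof -
    have solve: "(m + 1) * x = (m - 1) * y \<longleftrightarrow> x = (m - 1) / (m + 1) * y" for x y
      using m by (auto simp: field_simps)
    have "u < u0" if u: "0 < u" "u < t" "u * odd_factor u = (m - 1) / (m + 1) * even_part u" for u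
    proof -
      have "(m - 1) / (m + 1) * even_part u < 0"
        using E_neg[of u] u m by (intro mult_pos_neg) auto
      then have "odd_factor u < 0"
        using u(1) unfolding u(3)[symmetric] by (simp add: mult_less_0_iff)
      then show ?thesis
        using odd_factor_strict_mono[of u0 u] u0 by (cases rule: linorder_cases[of u u0]) auto
    qed
    then have "{u\<in>{0<..<t}. (m + 1) * (u * odd_factor u) = (m - 1) * even_part u}
      = {u\<in>{0<..<u0}. u * odd_factor u = (m - 1) / (m + 1) * even_part u}"
      unfolding solve using u0t by (intro set_eqI) force
    then show ?thesis unfolding upper_image[OF less_imp_le[OF m]] by (simp only:)
  qed

  \<comment> \<open>the mass ratio \<open>m\<close> whose level \<open>(m - 1)/(m + 1)\<close> is the maximum \<open>M\<close>\<close>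
  define ms where "ms = (1 + M) / (1 - M)"
  define mss where "mss = 1 / L"
  have ms: "1 < ms" "ms < 51 / 49" and mss: "21 / 20 < mss"
    using M(1,2) L(1,2) by (simp_all add: ms_def mss_def pos_less_divide_eq pos_divide_less_eq)
  have ratio: "(m - 1) / (m + 1) < M \<longleftrightarrow> m < ms" "M < (m - 1) / (m + 1) \<longleftrightarrow> ms < m"
    "(ms - 1) / (ms + 1) = M" if "m > 1" for m
  proof -
    have p: "m + 1 > 0" "1 - M > 0" using that M(2) by auto
    show "(m - 1) / (m + 1) < M \<longleftrightarrow> m < ms" "M < (m - 1) / (m + 1) \<longleftrightarrow> ms < m"
      unfolding ms_def pos_divide_less_eq[OF p(1)] pos_less_divide_eq[OF p(1)]
        pos_divide_less_eq[OF p(2)] pos_less_divide_eq[OF p(2)] by (auto simp: algebra_simps)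
    have "(1 - M) * ms = 1 + M" using p by (simp add: ms_def)
    then have "ms - 1 = M * (ms + 1)" by (simp add: algebra_simps)
    then show "(ms - 1) / (ms + 1) = M" using ms by simp
  qed
  have upper_lt: "card (upper m) = 2" if "1 < m" "m < ms" for m
    unfolding upper_set[OF that(1)] card_radius_image using that ratio(1)[of m] by (intro M(3)) auto
  have upper_eq: "card (upper ms) = 1"
    unfolding upper_set[OF ms(1)] card_radius_image ratio(3)[OF ms(1)] by (rule M(4))
  have upper_gt: "upper m = {}" if "ms < m" for m
  proof -
    have "m > 1" using ms that by simp
    then show ?thesis
      unfolding upper_set[OF \<open>m > 1\<close>] using M(5)[of "(m - 1) / (m + 1)"] ratio(2)[of m] that by simp
  qed

  have inj_recip: "inj_on (\<lambda>b::real. 1 / b) S" for S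
    by (auto simp: inj_on_def)
  have outer_set: "outer m = (\<lambda>b. 1 / b) ` {b\<in>{0<..<z1}. b * crown_force b = 1 / m * crown_force (1 / b)}"
    if "m \<ge> 1" for m
    unfolding outer_def using that s(1) by (intro admissible_reciprocal_image) auto
  have outer_lt: "outer m = {}" if "1 \<le> m" "m < mss" for m
  proof -
    have "L < 1 / m" using that L(1) by (simp add: mss_def field_simps)
    then show ?thesis unfolding outer_set[OF that(1)] by (simp only: L(5) image_empty)
  qed
  have outer_eq: "card (outer mss) = 1"
  proof -
    have "1 / mss = L" "mss \<ge> 1" using mss by (simp_all add: mss_def)
    then show ?thesis
      unfolding outer_set[OF \<open>mss \<ge> 1\<close>] card_image[OF inj_recip] by (simp only: L(4))
  qed
  have outer_gt: "card (outer m) = 2" if "mss < m" for m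
  proof -
    have m: "m \<ge> 1" using mss that by simp
    have "0 < 1 / m" "1 / m < L" using that m L(1) by (simp_all add: mss_def field_simps)
    then show ?thesis
      unfolding outer_set[OF m] card_image[OF inj_recip] by (rule L(3))
  qed

  have split: "admissible_values 3 m = {a. a = 1 \<and> m = 1} \<union> lower m \<union> upper m \<union> outer m" (is "?A = ?B")
    if m: "m \<ge> 1" for m
  proof
    show "?A \<subseteq> ?B"
    proof
      fix a :: real
      assume "a \<in> ?A"
      then show "a \<in> ?B"
        using admissible_values_cases[OF assms m \<open>a \<in> ?A\<close>] by (auto simp: lower_def upper_def outer_def)
    qed
    have "1 \<in> admissible_values 3 1"
      by (simp add: admissible_values_def twisted_crown_3_iff)
    then show "?B \<subseteq> ?A"
      by (auto simp: lower_def upper_def outer_def)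
  qed
  have adm_1: "admissible_values 3 1 = {1, radius u0, 1 / radius u0}"
  proof -
    have "lower 1 = {1 / radius u0}" using lower[of 1] by auto
    moreover have "outer 1 = {}" using mss by (intro outer_lt) auto
    ultimately show ?thesis
      unfolding split[OF order_refl] upper_1 by auto
  qed
  have adm: "admissible_values 3 m = lower m \<union> upper m \<union> outer m" if "m > 1" for m
    unfolding split[OF less_imp_le[OF that]] using that by simp
  have lower_card: "card (lower m) = 1" "finite (lower m)" if "m > 1" for m
    using lower[of m] that by auto
  have num: "num_different_crowns 3 m = 1 + card (upper m) + card (outer m)" if "m > 1" for m
  proof -
    have "finite (upper m)"
      using upper_lt[of m] upper_eq upper_gt[of m] that
      by (cases rule: linorder_cases[of m ms]) (auto intro!: card_ge_0_finite)
    moreover have "finite (outer m)"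
      using outer_gt[of m] outer_eq outer_lt[of m] that
      by (cases rule: linorder_cases[of m mss]) (auto intro!: card_ge_0_finite)
    moreover have "lower m \<inter> upper m = {}" "(lower m \<union> upper m) \<inter> outer m = {}"
      using s(3,4) z1' z2' by (auto simp: lower_def upper_def outer_def)
    ultimately show ?thesis
      unfolding num_different_crowns_eq_card[OF that] adm[OF that]
      using lower_card[OF that] by (simp add: card_Un_disjoint)
  qed
  have exists: "\<exists>a. twisted_crown 3 a m" if "m \<ge> 1" for m
    using lower[OF that] by (auto simp: lower_def admissible_values_def)
  have less: "ms < mss" "1 < mss" using ms mss by auto
  have sub: "lower m \<subseteq> {1 / z2<..<1}" "upper m \<subseteq> {1<..<z2}" for m
    unfolding lower_def upper_def by blast+
  have wide: "{1 / z2<..<1} \<subseteq> {1 / z2<..<z2}" "{1<..<z2} \<subseteq> {1 / z2<..<z2}"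
    using s(3) less_trans[OF z2'(2)] by auto
  have "num_different_crowns 3 m = 3 \<and> admissible_values 3 m \<subseteq> {1 / z2<..<z2}" if m: "m \<in> {1<..<ms}" for m
  proof -
    have m': "1 < m" "m < ms" "m < mss" using m less by auto
    have "num_different_crowns 3 m = 3"
      unfolding num[OF m'(1)] upper_lt[OF m'(1,2)] outer_lt[OF less_imp_le[OF m'(1)] m'(3)] by simp
    moreover have "admissible_values 3 m \<subseteq> {1 / z2<..<z2}"
      unfolding adm[OF m'(1)] outer_lt[OF less_imp_le[OF m'(1)] m'(3)] using sub[of m] wide by blast
    ultimately show ?thesis ..
  qed
  moreover have "num_different_crowns 3 m = 3 \<and> card (lower m) = 1 \<and> card (outer m) = 2"
    if m: "m \<in> {mss<..}" for m
  proof -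
    have m': "1 < m" "ms < m" "mss < m" using m less by auto
    show ?thesis
      unfolding num[OF m'(1)] upper_gt[OF m'(2)] outer_gt[OF m'(3)] lower_card[OF m'(1)] by simp
  qed
  moreover have "num_different_crowns 3 m = 1 \<and> admissible_values 3 m \<subseteq> {1 / z2<..<1}"
    if m: "m \<in> {ms<..<mss}" for m
  proof -
    have m': "1 < m" "ms < m" "m < mss" using m ms by auto
    have "num_different_crowns 3 m = 1"
      unfolding num[OF m'(1)] upper_gt[OF m'(2)] outer_lt[OF less_imp_le[OF m'(1)] m'(3)] by simp
    moreover have "admissible_values 3 m \<subseteq> {1 / z2<..<1}"
      unfolding adm[OF m'(1)] upper_gt[OF m'(2)] outer_lt[OF less_imp_le[OF m'(1)] m'(3)] using sub[of m] by blast
    ultimately show ?thesis ..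
  qed
  moreover have "num_different_crowns 3 1 = 2"
    using num_different_crowns_1[OF adm_1] radius_less_iff[of 0 u0] u0 by (simp add: radius_0)
  moreover have "num_different_crowns 3 ms = 2"
    using num[of ms] upper_eq outer_lt[of ms] ms less by simp
  moreover have "num_different_crowns 3 mss = 2"
    using num[of mss] upper_gt[of mss] outer_eq ms less by simp
  ultimately show ?thesis
    using exists ms(1) less unfolding lower_def outer_def by blast
qed

end
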